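(* Let $\{X_n\}_{n\in\mathbb{N}}$ be a sequence of asymptotic expanders with uniformly bounded geometry, and let $X$ be their coarse disjoint union. Then $X$ cannot be coarsely embedded into any $L^p$-space with $1\le p<\infty$, nor into any uniformly curved Banach space.
   Context: For a metric space $(X,d)$, $A\subseteq X$ and $R>0$, let $\partial_R A=\{x\in X\setminus A : d(x,A)\le R\}$. A sequence $\{X_n\}_{n\in\mathbb{N}}$ of finite metric spaces with $|X_n|\to\infty$ is a sequence of asymptotic expanders if for every $\alpha\in(0,\frac12]$ there exist $c_\alpha\in(0,1)$ and $R_\alpha>0$ such that for every $n$ and every $A\subseteq X_n$ with $\alpha|X_n|\le|A|\le\frac12|X_n|$ we have $|\partial_{R_\alpha}A|>c_\alpha|A|$. The sequence has uniformly bounded geometry if for every $R>0$, $\sup_n\sup_{x\in X_n}|B(x,R)|<\infty$ (closed balls in $X_n$). A coarse disjoint union of finite metric spaces $\{(X_n,d_n)\}$ is the set $X=\bigsqcup_n X_n$ with a metric $d$ that restricts to $d_n$ on each $X_n$ and satisfies $d(X_n,X_m)\ge n+m+\mathrm{diam}(X_n)+\mathrm{diam}(X_m)$ for $n\ne m$. A map $f:X\to Y$ of metric spaces is a coarse embedding if there are unbounded increasing functions $\rho_-,\rho_+:[0,\infty)\to[0,\infty)$ with $\rho_-(d_X(x,x'))\le d_Y(f(x),f(x'))\le\rho_+(d_X(x,x'))$ for all $x,x'\in X$. (A coarse disjoint union of the $X_n$ coarsely embeds into a Banach space $E$ if and only if there are coarse embeddings $X_n\to E$ with the same control functions $\rho_\pm$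 for all $n$.) An $L^p$-space is a space $L^p(\Omega,\mu)$ of (real- or complex-valued) $p$-integrable functions on a measure space. A complex Banach space $E$ is uniformly curved (Pisier) if there is a function $\Delta_E(\varepsilon)$ with $\Delta_E(\varepsilon)\to0$ as $\varepsilon\to0^+$ such that every operator $T:L^2\to L^2$ with $\|T\|_{L^2\to L^2}\le\varepsilon$ that is simultaneously contractive (norm $\le1$) on $L^1$ and on $L^\infty$ satisfies $\|T\otimes\mathrm{id}_E\|_{L^2(E)\to L^2(E)}\le\Delta_E(\varepsilon)$. *)

theory Defs
  imports "HOL-Probability.Essential_Supremum"
begin

section \<open>Asymptotic expanders\<close>

(* The infimum is taken in the extended reals, so that d(x, {}) = \<infinity>. *)
definition outer_boundary :: "'a set \<Rightarrow> ('a \<Rightarrow> 'a \<Rightarrow> real) \<Rightarrow> real \<Rightarrow> 'a set \<Rightarrow> 'a set" where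
  "outer_boundary X d R A = {x \<in> X - A. (INF a\<in>A. ereal (d x a)) \<le> ereal R}"

definition asymptotic_expanders :: "(nat \<Rightarrow> 'a set) \<Rightarrow> (nat \<Rightarrow> 'a \<Rightarrow> 'a \<Rightarrow> real) \<Rightarrow> bool" where
  "asymptotic_expanders X d \<longleftrightarrow>
     (\<forall>n. Metric_space (X n) (d n) \<and> finite (X n)) \<and>
     filterlim (\<lambda>n. card (X n)) at_top sequentially \<and>
     (\<forall>\<alpha>::real. 0 < \<alpha> \<and> \<alpha> \<le> 1/2 \<longrightarrow>
        (\<exists>c R. 0 < c \<and> c < 1 \<and> 0 < R \<and>
          (\<forall>n A. A \<subseteq> X n \<and> \<alpha> * real (card (X n)) \<le> real (card A) \<and>
                 real (card A) \<le> 1/2 * real (card (X n)) \<longrightarrow>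
                 real (card (outer_boundary (X n) (d n) R A)) > c * real (card A))))"

definition uniformly_bounded_geometry ::
    "(nat \<Rightarrow> 'a set) \<Rightarrow> (nat \<Rightarrow> 'a \<Rightarrow> 'a \<Rightarrow> real) \<Rightarrow> bool" where
  "uniformly_bounded_geometry X d \<longleftrightarrow>
     (\<forall>R>0. \<exists>N. \<forall>n. \<forall>x\<in>X n.
        finite (Metric_space.mcball (X n) (d n) x R) \<and>
        card (Metric_space.mcball (X n) (d n) x R) \<le> N)"


section \<open>Coarse disjoint unions and coarse embeddings\<close>

definition metric_diam :: "'a set \<Rightarrow> ('a \<Rightarrow> 'a \<Rightarrow> real) \<Rightarrow> real" where
  "metric_diam X d = (SUP (x, y)\<in>X \<times> X. d x y)"

definition is_coarse_disjoint_union ::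
    "(nat \<Rightarrow> 'a set) \<Rightarrow> (nat \<Rightarrow> 'a \<Rightarrow> 'a \<Rightarrow> real) \<Rightarrow> (nat \<times> 'a \<Rightarrow> nat \<times> 'a \<Rightarrow> real) \<Rightarrow> bool" where
  "is_coarse_disjoint_union X d D \<longleftrightarrow>
     Metric_space (Sigma UNIV X) D \<and>
     (\<forall>n. \<forall>x\<in>X n. \<forall>y\<in>X n. D (n, x) (n, y) = d n x y) \<and>
     (\<forall>n m. n \<noteq> m \<longrightarrow> (\<forall>x\<in>X n. \<forall>y\<in>X m.
        D (n, x) (m, y) \<ge> real n + real m + metric_diam (X n) (d n) + metric_diam (X m) (d m)))"

definition control_function :: "(real \<Rightarrow> real) \<Rightarrow> bool" where
  "control_function \<rho> \<longleftrightarrow>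
     \<rho> \<in> {0..} \<rightarrow> {0..} \<and> mono_on {0..} \<rho> \<and> \<not> bdd_above (\<rho> ` {0..})"

definition coarse_embedding ::
    "'a set \<Rightarrow> ('a \<Rightarrow> 'a \<Rightarrow> real) \<Rightarrow> 'b set \<Rightarrow> ('b \<Rightarrow> 'b \<Rightarrow> real) \<Rightarrow> ('a \<Rightarrow> 'b) \<Rightarrow> bool" where
  "coarse_embedding X dX Y dY f \<longleftrightarrow>
     f \<in> X \<rightarrow> Y \<and>
     (\<exists>\<rho>1 \<rho>2. control_function \<rho>1 \<and> control_function \<rho>2 \<and>
        (\<forall>x\<in>X. \<forall>x'\<in>X. \<rho>1 (dX x x') \<le> dY (f x) (f x') \<and> dY (f x) (f x') \<le> \<rho>2 (dX x x')))"

definition coarsely_embeddable ::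
    "'a set \<Rightarrow> ('a \<Rightarrow> 'a \<Rightarrow> real) \<Rightarrow> 'b set \<Rightarrow> ('b \<Rightarrow> 'b \<Rightarrow> real) \<Rightarrow> bool" where
  "coarsely_embeddable X dX Y dY \<longleftrightarrow> (\<exists>f. coarse_embedding X dX Y dY f)"


section \<open>Lebesgue spaces\<close>

(* Elements of L^p are represented by functions, and equality in L^p is equality almost everywhere;
   Lp_dist is thus a pseudometric on Lp_fun. A coarse embedding into this pseudometric space is the
   same thing as a choice of representatives of a coarse embedding into the quotient. *)
definition Lp_fun :: "'w measure \<Rightarrow> real \<Rightarrow> ('w \<Rightarrow> 'k::{real_normed_vector, second_countable_topology}) set" where
  "Lp_fun M p = {f \<in> borel_measurable M. integrable M (\<lambda>x. norm (f x) powr p)}"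

definition Lp_norm :: "'w measure \<Rightarrow> real \<Rightarrow> ('w \<Rightarrow> 'k::real_normed_vector) \<Rightarrow> real" where
  "Lp_norm M p f = (LINT x|M. norm (f x) powr p) powr (1 / p)"

definition Lp_dist :: "'w measure \<Rightarrow> real \<Rightarrow> ('w \<Rightarrow> 'k::real_normed_vector) \<Rightarrow> ('w \<Rightarrow> 'k) \<Rightarrow> real" where
  "Lp_dist M p f g = Lp_norm M p (\<lambda>x. f x - g x)"

definition Linf_norm :: "'w measure \<Rightarrow> ('w \<Rightarrow> 'k::real_normed_vector) \<Rightarrow> ereal" where
  "Linf_norm M f = esssup M (\<lambda>x. ereal (norm (f x)))"


section \<open>Uniformly curved complex Banach spaces\<close>

class complex_banach = banach +
  fixes scaleC :: "complex \<Rightarrow> 'a \<Rightarrow> 'a"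
  assumes scaleC_add_right: "scaleC a (x + y) = scaleC a x + scaleC a y"
    and scaleC_add_left: "scaleC (a + b) x = scaleC a x + scaleC b x"
    and scaleC_scaleC: "scaleC a (scaleC b x) = scaleC (a * b) x"
    and scaleC_of_real: "scaleC (complex_of_real r) x = scaleR r x"
    and norm_scaleC: "norm (scaleC a x) = cmod a * norm x"

(* T represents an operator on complex L^2 with norm at most \<epsilon>. The bound implies
   that T respects equality almost everywhere. *)
definition L2_operator_bound ::
    "'w measure \<Rightarrow> real \<Rightarrow> (('w \<Rightarrow> complex) \<Rightarrow> ('w \<Rightarrow> complex)) \<Rightarrow> bool" where
  "L2_operator_bound M \<epsilon> T \<longleftrightarrow>
     T \<in> Lp_fun M 2 \<rightarrow> Lp_fun M 2 \<and>
     (\<forall>f\<in>Lp_fun M 2. \<forall>g\<in>Lp_fun M 2. \<forall>a b.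
        AE x in M. T (\<lambda>y. a * f y + b * g y) x = a * T f x + b * T g x) \<and>
     (\<forall>f\<in>Lp_fun M 2. Lp_norm M 2 (T f) \<le> \<epsilon> * Lp_norm M 2 f)"

definition L1_contractive :: "'w measure \<Rightarrow> (('w \<Rightarrow> complex) \<Rightarrow> ('w \<Rightarrow> complex)) \<Rightarrow> bool" where
  "L1_contractive M T \<longleftrightarrow>
     (\<forall>f\<in>Lp_fun M 2 \<inter> Lp_fun M 1. T f \<in> Lp_fun M 1 \<and> Lp_norm M 1 (T f) \<le> Lp_norm M 1 f)"

definition Linf_contractive :: "'w measure \<Rightarrow> (('w \<Rightarrow> complex) \<Rightarrow> ('w \<Rightarrow> complex)) \<Rightarrow> bool" where
  "Linf_contractive M T \<longleftrightarrow> (\<forall>f\<in>Lp_fun M 2. Linf_norm M (T f) \<le> Linf_norm M f)"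

(* The norm of T \<otimes> id_E on L^2(E) is at most C. Finite sums of elementary tensors f \<otimes> e, that is of
   functions x \<mapsto> f x \<cdot> e, are dense in the Bochner space L^2(E), and T \<otimes> id_E is defined on them
   by f \<otimes> e \<mapsto> T f \<otimes> e. *)
definition tensor_id_bound ::
    "'e::complex_banach itself \<Rightarrow> 'w measure \<Rightarrow> (('w \<Rightarrow> complex) \<Rightarrow> ('w \<Rightarrow> complex)) \<Rightarrow> real \<Rightarrow> bool" where
  "tensor_id_bound E M T C \<longleftrightarrow>
     (\<forall>(k::nat) f. \<forall>e :: nat \<Rightarrow> 'e. (\<forall>i<k. f i \<in> Lp_fun M 2) \<longrightarrow>
        Lp_norm M 2 (\<lambda>x. \<Sum>i<k. scaleC (T (f i) x) (e i))
          \<le> C * Lp_norm M 2 (\<lambda>x. \<Sum>i<k. scaleC (f i x) (e i)))"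

(* L^2 ranges over all measure spaces whose points are real numbers, because HOL does not allow
   quantification over the underlying type inside a definition. This includes the counting
   measures and all Borel measures on the line. *)
definition uniformly_curved :: "'e::complex_banach itself \<Rightarrow> bool" where
  "uniformly_curved E \<longleftrightarrow>
     (\<exists>\<Delta> :: real \<Rightarrow> real. (\<Delta> \<longlongrightarrow> 0) (at_right 0) \<and>
        (\<forall>\<epsilon>>0. \<forall>(M :: real measure) T.
           L2_operator_bound M \<epsilon> T \<and> L1_contractive M T \<and> Linf_contractive M T
             \<longrightarrow> tensor_id_bound E M T (\<Delta> \<epsilon>)))"

end

theory Submission
  imports Defs
begin

text \<open>Removing from each space a largest subset of small boundary leaves a genuine bounded-degree
  expander that contains most of the points. Expanders satisfy the Poincare inequality for
  \<open>p\<close>-th powers of real functions, by the discrete coarea formula around a median, hence for complex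
  functions and, by integration, for maps into \<open>L\<^sup>p\<close>. For a uniformly curved target, the spectral
  gap makes half the difference of the \<open>k\<close>-step lazy random walk and the averaging operator small
  on \<open>L\<^sup>2\<close>, and it is contractive on \<open>L\<^sup>1\<close> and \<open>L\<^sup>\<infinity>\<close>; so its vector-valued extension is small, which
  is a Poincare inequality again. In each case a coarse embedding would map a positive proportion of
  the points of an expander into one ball, and hence these points would lie in a ball of bounded
  radius, contradicting bounded geometry.\<close>

section \<open>Expanders inside asymptotic expanders\<close>

text \<open>Asymptotic expansion controls only sets of a fixed proportion, whereas a Poincare
  inequality tests sets of every size, and pieces of vanishing proportion may be almost cut off from
  the rest. This is what the removal cures; with \<alpha> = 1/4 the removed set is smaller than a
  quarter of the space. Bounded geometry serves there to compare the boundary of a set with that of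
  its complement. The Poincare constants have to depend on the degree bound and the expansion
  constant alone, so that they are common to all spaces of the sequence. The graphs need not be
  regular. Giving every neighbour the same weight 1/(2N) makes the walk symmetric, so that the
  uniform measure is stationary. A difference of two contractions may have norm 2, hence the factor
  one half. The spectral gap for scalar functions is uniform, so a fixed number of steps makes the
  scalar norm as small as uniform curvature requires.\<close>

lemma outer_boundary_finite:
  assumes "finite A"
  shows "outer_boundary X d R A = {x \<in> X - A. \<exists>a\<in>A. d x a \<le> R}"
proof -
  have "(INF a\<in>A. ereal (d x a)) \<le> ereal R \<longleftrightarrow> (\<exists>a\<in>A. d x a \<le> R)" for x
  proof (cases "A = {}")
    case False
    then have "(INF a\<in>A. ereal (d x a)) = Min ((\<lambda>a. ereal (d x a)) ` A)"
      using assms by (simp add: Min_Inf)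
    then show ?thesis
      using False assms by (simp add: Min_le_iff)
  qed (simp add: top_ereal_def)
  then show ?thesis
    by (simp add: outer_boundary_def)
qed

text \<open>Removing a largest set \<open>F\<close> with small boundary leaves an expander: a set \<open>A\<close> of
  small boundary in the rest could be added to \<open>F\<close>, unless \<open>A \<union> F\<close> is about half of the space, and
  then its complement has large boundary.\<close>

lemma expander_subset:
  fixes X :: "'a set" and R c :: real and N :: nat
  assumes "Metric_space X d" and fin: "finite X" and c: "0 < c" and N: "0 < N"
    and ball: "\<And>x. x \<in> X \<Longrightarrow> card (Metric_space.mcball X d x R) \<le> N"
    and exp: "\<And>A. A \<subseteq> X \<Longrightarrow> 1/4 * real (card X) \<le> real (card A) \<Longrightarrow>
        real (card A) \<le> 1/2 * real (card X) \<Longrightarrow>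
        c * real (card A) < real (card (outer_boundary X d R A))"
  shows "\<exists>Y\<subseteq>X. 3/4 * real (card X) \<le> real (card Y) \<and>
    (\<forall>A\<subseteq>Y. A \<noteq> {} \<longrightarrow> 2 * card A \<le> card Y \<longrightarrow>
       c / (2 * real N) * real (card A) \<le> real (card {y \<in> Y - A. \<exists>x\<in>A. d x y \<le> R}))"
proof -
  interpret Metric_space X d by fact
  define bd where "bd A = {y \<in> X - A. \<exists>x\<in>A. d x y \<le> R}" for A
  \<comment> \<open>\<open>N\<close> pays for passing from the boundary of a set to that of its
    complement. The 2 settles the last comparison, as half of 5/8 is below 3/8.\<close>
  define c' where "c' = c / (2 * real N)"
  have c': "0 < c'" "c' \<le> c"
    using c N by (auto simp: c'_def field_simps)
  have bd: "outer_boundary X d R A = bd A" if "A \<subseteq> X" for A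
    using outer_boundary_finite[of A X d R] finite_subset[OF that fin] that
    by (auto simp: bd_def commute)
  have finbd: "finite (bd A)" for A
    using fin by (auto simp: bd_def)
  have fincard: "finite A" if "A \<subseteq> X" for A
    using that fin finite_subset by blast
  define bad where "bad F \<longleftrightarrow> F \<subseteq> X \<and> real (card F) \<le> 1/2 * real (card X) \<and>
    real (card (bd F)) \<le> c' * real (card F)" for F
  have "bad {}"
    by (simp add: bad_def bd_def)
  moreover have "card F \<le> card X" if "bad F" for F
    using that fin by (simp add: bad_def card_mono)
  ultimately obtain F where F: "bad F" and max: "\<And>F'. bad F' \<Longrightarrow> card F' \<le> card F"
    using ex_has_greatest_nat[of bad "{}" card "Suc (card X)"] by (auto simp: less_Suc_eq_le)
  have FX: "F \<subseteq> X" "real (card F) \<le> 1/2 * real (card X)" "real (card (bd F)) \<le> c' * real (card F)"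
    using F by (auto simp: bad_def)
  have Fsmall: "real (card F) < 1/4 * real (card X)"
  proof (rule ccontr)
    assume "\<not> ?thesis"
    then have "c * real (card F) < real (card (bd F))"
      using exp[of F] FX bd by auto
    moreover have "c' * real (card F) \<le> c * real (card F)"
      using c' by (intro mult_right_mono) auto
    ultimately show False
      using FX by linarith
  qed
  have cardY: "real (card (X - F)) = real (card X) - real (card F)"
    using FX(1) fin by (simp add: card_Diff_subset fincard card_mono of_nat_diff)
  show ?thesis
  proof (intro exI[of _ "X - F"] conjI allI impI)
    show "X - F \<subseteq> X" by auto
    show "3/4 * real (card X) \<le> real (card (X - F))"
      using cardY Fsmall by linarith
    fix A assume A: "A \<subseteq> X - F" "A \<noteq> {}" "2 * card A \<le> card (X - F)"
    show "c / (2 * real N) * real (card A) \<le> real (card {y \<in> X - F - A. \<exists>x\<in>A. d x y \<le> R})"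
    proof (rule ccontr)
      assume neg: "\<not> ?thesis"
      have AX: "A \<union> F \<subseteq> X" using A FX by auto
      have cardAF: "card (A \<union> F) = card A + card F"
        using A FX fincard by (intro card_Un_disjoint) auto
      have "card A > 0"
        using A fincard[of A] AX by (auto simp: card_gt_0_iff)
      have "bd (A \<union> F) \<subseteq> {y \<in> X - F - A. \<exists>x\<in>A. d x y \<le> R} \<union> bd F"
        by (auto simp: bd_def)
      then have "card (bd (A \<union> F)) \<le> card ({y \<in> X - F - A. \<exists>x\<in>A. d x y \<le> R} \<union> bd F)"
        using fin finbd by (intro card_mono) auto
      also have "\<dots> \<le> card {y \<in> X - F - A. \<exists>x\<in>A. d x y \<le> R} + card (bd F)"
        by (rule card_Un_le)
      finally have "real (card (bd (A \<union> F))) \<le>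
          real (card {y \<in> X - F - A. \<exists>x\<in>A. d x y \<le> R}) + real (card (bd F))"
        by (simp flip: of_nat_add)
      also have "\<dots> \<le> c' * real (card (A \<union> F))"
        using neg FX(3) unfolding c'_def[symmetric] cardAF of_nat_add distrib_left by linarith
      finally have bdAF: "real (card (bd (A \<union> F))) \<le> c' * real (card (A \<union> F))" .
      \<comment> \<open>The union has small boundary and is larger than the maximal
        \<open>F\<close>, so it can fail to be bad only by exceeding half of the space.\<close>
      have big: "real (card (A \<union> F)) > 1/2 * real (card X)"
        using max[of "A \<union> F"] \<open>card A > 0\<close> bdAF AX by (force simp: bad_def cardAF)
      \<comment> \<open>\<open>A\<close> is at most half of \<open>X - F\<close>, so the union has
        at most (1 + 1/4)/2 of the points.\<close>
      have small: "real (card (A \<union> F)) \<le> 5/8 * real (card X)"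
        using A(3) cardAF cardY Fsmall by linarith
      define B where "B = X - (A \<union> F)"
      have BX: "B \<subseteq> X" by (auto simp: B_def)
      have cardB: "real (card B) = real (card X) - real (card (A \<union> F))"
        using AX fin unfolding B_def by (subst card_Diff_subset) (auto simp: fincard card_mono of_nat_diff)
      have "c * real (card B) < real (card (bd B))"
        using exp[of B] BX bd cardB big small by auto
      also have "card (bd B) \<le> card (bd (A \<union> F)) * N"
      proof -
        \<comment> \<open>Being within \<open>R\<close> is symmetric: a point of
          \<open>A \<union> F\<close> close to some \<open>b\<close> in \<open>B\<close> puts
          \<open>b\<close> into the boundary of \<open>A \<union> F\<close> and itself lies in the
          ball about \<open>b\<close>.\<close>
        have "bd B \<subseteq> (\<Union>b\<in>bd (A \<union> F). mcball b R)"
        proof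
          fix x assume "x \<in> bd B"
          then obtain b where b: "x \<in> X" "x \<notin> B" "b \<in> B" "d b x \<le> R"
            by (auto simp: bd_def)
          then have "b \<in> bd (A \<union> F)"
            using commute[of b x] by (auto simp: bd_def B_def)
          then show "x \<in> (\<Union>b\<in>bd (A \<union> F). mcball b R)"
            using b BX by auto
        qed
        moreover have "finite (\<Union>b\<in>bd (A \<union> F). mcball b R)"
          using finbd by (auto intro!: fincard)
        ultimately have "card (bd B) \<le> card (\<Union>b\<in>bd (A \<union> F). mcball b R)"
          by (intro card_mono)
        also have "\<dots> \<le> (\<Sum>b\<in>bd (A \<union> F). card (mcball b R))"
          by (rule card_UN_le[OF finbd])
        also have "\<dots> \<le> (\<Sum>b\<in>bd (A \<union> F). N)"
          by (intro sum_mono ball) (auto simp: bd_def)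
        finally show ?thesis by simp
      qed
      finally have "c * real (card B) < real (card (bd (A \<union> F))) * real N"
        by simp
      also have "\<dots> \<le> c' * real (card (A \<union> F)) * real N"
        using bdAF by (simp add: mult_right_mono)
      also have "\<dots> = c / 2 * real (card (A \<union> F))"
        using N by (simp add: c'_def)
      also have "\<dots> \<le> c / 2 * (5/8 * real (card X))"
        using small c by (intro mult_left_mono) auto
      also have "\<dots> \<le> c * (3/8 * real (card X))"
        using c by simp
      also have "\<dots> \<le> c * real (card B)"
        using cardB small c by (intro mult_left_mono) auto
      finally show False by simp
    qed
  qed
qed

section \<open>Poincare inequalities on expanders\<close>

text \<open>The constants are explicit so that one estimate serves all graphs of a sequence.
  \<open>E\<close> may relate a vertex to itself, as the relation of distance at most
  \<open>R\<close> does; loops contribute nothing to sums of differences.\<close>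

locale expander =
  fixes V :: "'a set" and E :: "'a \<Rightarrow> 'a \<Rightarrow> bool" and N :: nat and c :: real
  assumes finite_V: "finite V" and V_nonempty: "V \<noteq> {}"
    and N_pos: "0 < N" and c_pos: "0 < c"
    and E_sym: "E x y \<Longrightarrow> E y x"
    and degree: "x \<in> V \<Longrightarrow> card {y\<in>V. E x y} \<le> N"
    and expansion: "A \<subseteq> V \<Longrightarrow> A \<noteq> {} \<Longrightarrow> 2 * card A \<le> card V \<Longrightarrow>
      c * real (card A) \<le> real (card {y \<in> V - A. \<exists>x\<in>A. E x y})"
begin

definition nbr :: "'a \<Rightarrow> 'a set" where
  "nbr x = {y\<in>V. E x y}"

text \<open>The pairs are ordered, so an edge between distinct vertices counts in both directions.
  Vector values are allowed for the sake of \<open>sum_walk\<close>.\<close>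

definition edge_sum :: "('a \<Rightarrow> 'a \<Rightarrow> 'v::comm_monoid_add) \<Rightarrow> 'v" where
  "edge_sum h = (\<Sum>x\<in>V. \<Sum>y\<in>nbr x. h x y)"

lemma finite_nbr [simp]: "finite (nbr x)"
  using finite_V by (simp add: nbr_def)

lemma card_nbr: "x \<in> V \<Longrightarrow> card (nbr x) \<le> N"
  using degree by (simp add: nbr_def)

lemma nbr_subset: "y \<in> nbr x \<Longrightarrow> y \<in> V"
  by (simp add: nbr_def)

lemma card_V_pos: "0 < card V"
  using finite_V V_nonempty by (simp add: card_gt_0_iff)

lemma edge_sum_swap: "edge_sum (\<lambda>x y. h y x) = edge_sum h"
proof -
  have eq: "{x \<in> V. E x y} = {x \<in> V. E y x}" for y
    using E_sym by blast
  have "edge_sum (\<lambda>x y. h y x) = (\<Sum>y\<in>V. \<Sum>x | x \<in> V \<and> E x y. h y x)"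
    unfolding edge_sum_def nbr_def by (rule sum.swap_restrict) (auto simp: finite_V)
  then show ?thesis
    by (simp add: edge_sum_def nbr_def eq)
qed

lemma edge_sum_mono:
  fixes h :: "'a \<Rightarrow> 'a \<Rightarrow> real"
  assumes "\<And>x y. x \<in> V \<Longrightarrow> y \<in> V \<Longrightarrow> E x y \<Longrightarrow> h x y \<le> h' x y"
  shows "edge_sum h \<le> edge_sum h'"
  unfolding edge_sum_def by (intro sum_mono assms) (auto simp: nbr_def)

lemma edge_sum_add: "edge_sum (\<lambda>x y. h x y + h' x y) = edge_sum h + edge_sum h'"
  by (simp add: edge_sum_def sum.distrib)

lemma edge_sum_cmult: "edge_sum (\<lambda>x y. (a::real) * h x y) = a * edge_sum h"
  by (simp add: edge_sum_def sum_distrib_left)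

lemma edge_sum_fst_le:
  assumes "\<And>x. x \<in> V \<Longrightarrow> 0 \<le> (g x :: real)"
  shows "edge_sum (\<lambda>x y. g x) \<le> real N * (\<Sum>x\<in>V. g x)"
  using assms card_nbr
  by (auto simp: edge_sum_def sum_distrib_left intro!: sum_mono mult_right_mono)

lemma edge_sum_snd_le:
  assumes "\<And>x. x \<in> V \<Longrightarrow> 0 \<le> (g x :: real)"
  shows "edge_sum (\<lambda>x y. g y) \<le> real N * (\<Sum>x\<in>V. g x)"
  using edge_sum_fst_le[of g] edge_sum_swap[of "\<lambda>x y. g x"] assms by simp

text \<open>Layer by layer: subtracting the least positive value times the indicator of the support
  shrinks the support. Each layer is the indicator of at most half of the vertices, and for such an
  indicator the claim is vertex expansion.\<close>

lemma coarea:
  fixes g :: "'a \<Rightarrow> real"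
  assumes "\<And>x. x \<in> V \<Longrightarrow> 0 \<le> g x" and "2 * card {x\<in>V. 0 < g x} \<le> card V"
  shows "c * (\<Sum>x\<in>V. g x) \<le> edge_sum (\<lambda>x y. \<bar>g x - g y\<bar>)"
  using assms
proof (induction "card {x\<in>V. 0 < g x}" arbitrary: g rule: less_induct)
  case less
  define A where "A = {x\<in>V. 0 < g x}"
  have finA: "finite A" and AV: "A \<subseteq> V" using finite_V by (auto simp: A_def)
  show ?case
  proof (cases "A = {}")
    case True
    then have "g x = 0" if "x \<in> V" for x
      using less.prems(1)[OF that] that by (force simp: A_def)
    then show ?thesis
      by (simp add: edge_sum_def sum_nonneg)
  next
    case False
    define m where "m = Min (g ` A)"
    have m_in: "m \<in> g ` A" unfolding m_def using finA False by (intro Min_in) auto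
    have m_le: "m \<le> g x" if "x \<in> A" for x unfolding m_def using finA that by auto
    have m_pos: "0 < m" using m_in by (auto simp: A_def)
    define i where "i x = (if x \<in> A then 1 else (0::real))" for x
    define g' where "g' x = g x - m * i x" for x
    have g0: "g x = 0" if "x \<in> V" "x \<notin> A" for x
      using less.prems(1)[OF that(1)] that by (force simp: A_def)
    have sub: "{x\<in>V. 0 < g' x} \<subset> A"
    proof -
      obtain x where "x \<in> A" "g x = m" using m_in by auto
      then have "x \<notin> {x\<in>V. 0 < g' x}" by (simp add: g'_def i_def)
      moreover have "{x\<in>V. 0 < g' x} \<subseteq> A"
        by (auto simp: g'_def i_def A_def)
      ultimately show ?thesis using \<open>x \<in> A\<close> by blast
    qed
    have "card {x\<in>V. 0 < g' x} < card A"
      by (rule psubset_card_mono[OF finA sub])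
    moreover have "0 \<le> g' x" if "x \<in> V" for x
      using m_le less.prems(1)[OF that] by (auto simp: g'_def i_def)
    ultimately have IH: "c * (\<Sum>x\<in>V. g' x) \<le> edge_sum (\<lambda>x y. \<bar>g' x - g' y\<bar>)"
      using less.prems(2) by (intro less.hyps) (auto simp: A_def)
    \<comment> \<open>Nothing is lost here: \<open>g\<close> is at least \<open>m\<close> on
      \<open>A\<close> and 0 off \<open>A\<close>, so the two differences never have opposite
      signs.\<close>
    have split: "\<bar>g x - g y\<bar> = \<bar>g' x - g' y\<bar> + m * \<bar>i x - i y\<bar>" if "x \<in> V" "y \<in> V" for x y
      using g0[OF that(1)] g0[OF that(2)] m_le[of x] m_le[of y] m_pos
      by (auto simp: g'_def i_def)
    have "c * real (card A) \<le> real (card {y \<in> V - A. \<exists>x\<in>A. E x y})"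
      using expansion[of A] False AV less.prems(2) by (simp add: A_def)
    also have "\<dots> = (\<Sum>y\<in>{y \<in> V - A. \<exists>x\<in>A. E x y}. 1)"
      by simp
    also have "\<dots> \<le> (\<Sum>y\<in>{y \<in> V - A. \<exists>x\<in>A. E x y}. \<Sum>x\<in>nbr y. \<bar>i y - i x\<bar>)"
    proof (intro sum_mono)
      fix y assume "y \<in> {y \<in> V - A. \<exists>x\<in>A. E x y}"
      then obtain x where x: "y \<in> V" "y \<notin> A" "x \<in> A" "x \<in> nbr y"
        using AV E_sym by (auto simp: nbr_def)
      then have "1 = \<bar>i y - i x\<bar>" by (simp add: i_def)
      also have "\<dots> \<le> (\<Sum>x\<in>nbr y. \<bar>i y - i x\<bar>)"
        using x by (intro member_le_sum) auto
      finally show "1 \<le> (\<Sum>x\<in>nbr y. \<bar>i y - i x\<bar>)" .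
    qed
    also have "\<dots> \<le> edge_sum (\<lambda>x y. \<bar>i x - i y\<bar>)"
      unfolding edge_sum_def using finite_V by (intro sum_mono2) (auto intro: sum_nonneg)
    finally have bdA: "c * real (card A) \<le> edge_sum (\<lambda>x y. \<bar>i x - i y\<bar>)" .
    have "(\<Sum>x\<in>V. i x) = real (card A)"
      using AV finite_V by (simp add: i_def sum.If_cases Int_absorb1)
    then have "c * (\<Sum>x\<in>V. g x) = c * (\<Sum>x\<in>V. g' x) + m * (c * real (card A))"
      by (simp add: g'_def sum_subtractf algebra_simps flip: sum_distrib_left)
    also have "\<dots> \<le> edge_sum (\<lambda>x y. \<bar>g' x - g' y\<bar>) + m * edge_sum (\<lambda>x y. \<bar>i x - i y\<bar>)"
      using IH bdA m_pos by (intro add_mono mult_left_mono) auto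
    also have "\<dots> = edge_sum (\<lambda>x y. \<bar>g' x - g' y\<bar> + m * \<bar>i x - i y\<bar>)"
      by (simp add: edge_sum_add edge_sum_cmult)
    also have "\<dots> = edge_sum (\<lambda>x y. \<bar>g x - g y\<bar>)"
      unfolding edge_sum_def by (intro sum.cong refl) (metis split nbr_subset)
    finally show ?thesis .
  qed
qed

end

section \<open>Medians and the Poincare inequality for p-th powers\<close>

lemma ex_median:
  fixes f :: "'a \<Rightarrow> real"
  assumes "finite V"
  obtains m where "2 * card {x\<in>V. m < f x} \<le> card V" "2 * card {x\<in>V. f x < m} \<le> card V"
proof (cases "V = {}")
  case False
  \<comment> \<open>The median is the least value of \<open>f\<close> above which at most half of
    the points lie; the maximum of \<open>f\<close> is a candidate.\<close>
  define M where "M = {t \<in> f ` V. 2 * card {x\<in>V. t < f x} \<le> card V}"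
  have finM: "finite M" using assms by (simp add: M_def)
  have "Max (f ` V) \<in> M"
  proof -
    have "{x\<in>V. Max (f ` V) < f x} = {}" using assms by (auto simp: not_less)
    then have "card {x\<in>V. Max (f ` V) < f x} = 0" by (simp only: card.empty)
    moreover have "Max (f ` V) \<in> f ` V" using assms False by (intro Max_in) auto
    ultimately show ?thesis by (simp add: M_def)
  qed
  then have Min: "Min M \<in> M" using finM by (intro Min_in) auto
  define m where "m = Min M"
  have "2 * card {x\<in>V. f x < m} \<le> card V"
  proof (cases "{x\<in>V. f x < m} = {}")
    case True
    then have "card {x\<in>V. f x < m} = 0" by (simp only: card.empty)
    then show ?thesis by simp
  next
    case ne: False
    define t where "t = Max (f ` {x\<in>V. f x < m})"
    have t: "t \<in> f ` {x\<in>V. f x < m}" unfolding t_def using assms ne by (intro Max_in) auto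
    have t_max: "f x \<le> t" if "x \<in> V" "f x < m" for x
      unfolding t_def using assms that by (intro Max_ge) auto
    \<comment> \<open>\<open>t\<close> is the next value below the median. By minimality more than
      half of the points lie above \<open>t\<close>, and they are disjoint from those below the
      median.\<close>
    have "t \<notin> M"
      using t Min_le[OF finM, of t] unfolding m_def by (auto simp: not_le[symmetric])
    then have "card V < 2 * card {x\<in>V. t < f x}" using t by (auto simp: M_def)
    moreover have "card {x\<in>V. t < f x} + card {x\<in>V. f x < m} \<le> card V"
    proof -
      have "card {x\<in>V. t < f x} + card {x\<in>V. f x < m} = card ({x\<in>V. t < f x} \<union> {x\<in>V. f x < m})"
        using assms t_max by (intro card_Un_disjoint[symmetric]) (auto simp: not_less[symmetric])
      also have "\<dots> \<le> card V" using assms by (intro card_mono) auto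
      finally show ?thesis .
    qed
    ultimately show ?thesis by linarith
  qed
  then show ?thesis using that[of m] Min by (simp add: m_def M_def)
qed (use that in simp)

text \<open>The small factor \<eta> allows the second term to be absorbed later. Let b \<le> a. If a
  - b is at least the fraction \<theta> of a, then \<open>K\<close> pays for all of a^p; otherwise b
  exceeds (1 - \<theta>) a, and \<theta> is chosen by continuity so that b^p is at least (1 -
  \<eta>) a^p.\<close>

lemma powr_diff_bound_ex:
  fixes p \<eta> :: real
  assumes "0 < p" "0 < \<eta>"
  obtains K where "0 < K"
    "\<And>a b. 0 \<le> a \<Longrightarrow> 0 \<le> b \<Longrightarrow> \<bar>a powr p - b powr p\<bar> \<le> K * \<bar>a - b\<bar> powr p + \<eta> * (a powr p + b powr p)"
proof -
  have "((\<lambda>t. (1 - t) powr p) \<longlongrightarrow> (1 - 0) powr p) (at_right 0)"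
    by (intro tendsto_intros) auto
  then have "\<forall>\<^sub>F t in at_right 0. 1 - \<eta> < (1 - t) powr p"
    by (rule order_tendstoD) (use assms in auto)
  moreover have "\<forall>\<^sub>F t in at_right (0::real). 0 < t \<and> t < 1"
    by (auto intro!: eventually_conj eventually_at_right_less eventually_at_rightI[of 0 1])
  ultimately have "\<forall>\<^sub>F t in at_right 0. 1 - \<eta> < (1 - t) powr p \<and> 0 < t \<and> t < 1"
    by eventually_elim auto
  then obtain \<theta> where \<theta>: "1 - \<eta> < (1 - \<theta>) powr p" "0 < \<theta>" "\<theta> < 1"
    using eventually_happens trivial_limit_at_right_real by blast
  define K where "K = (1 / \<theta>) powr p"
  have K: "0 < K" using \<theta> by (simp add: K_def)
  have main: "a powr p - b powr p \<le> K * (a - b) powr p + \<eta> * a powr p" if "0 \<le> b" "b \<le> a" for a b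
  proof (cases "a - b \<ge> \<theta> * a")
    case True
    have "a powr p \<le> ((1 / \<theta>) * (a - b)) powr p"
      using True \<theta> that assms by (intro powr_mono2) (auto simp: field_simps)
    also have "\<dots> = K * (a - b) powr p"
      unfolding K_def using \<theta> that by (subst powr_mult) auto
    finally show ?thesis using assms by (smt (verit) mult_nonneg_nonneg powr_ge_zero)
  next
    case False
    have "((1 - \<theta>) * a) powr p \<le> b powr p"
    proof (intro powr_mono2)
      show "0 \<le> (1 - \<theta>) * a" using \<theta> that by (intro mult_nonneg_nonneg) auto
      show "(1 - \<theta>) * a \<le> b" using False by (simp add: algebra_simps)
    qed (use assms in auto)
    then have "(1 - \<theta>) powr p * a powr p \<le> b powr p"
      using \<theta> that by (simp add: powr_mult)
    moreover have "(1 - \<eta>) * a powr p \<le> (1 - \<theta>) powr p * a powr p"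
      using \<theta> by (intro mult_right_mono) auto
    moreover have "0 \<le> K * (a - b) powr p"
      using K by simp
    ultimately show ?thesis
      unfolding left_diff_distrib by linarith
  qed
  have mono: "b powr p \<le> a powr p" if "0 \<le> b" "b \<le> a" for a b :: real
    using that assms by (intro powr_mono2) auto
  have \<eta>: "0 \<le> \<eta> * a powr p" for a using assms by simp
  show ?thesis
  proof (rule that[OF K])
    fix a b :: real assume ab: "0 \<le> a" "0 \<le> b"
    show "\<bar>a powr p - b powr p\<bar> \<le> K * \<bar>a - b\<bar> powr p + \<eta> * (a powr p + b powr p)"
    proof (cases "b \<le> a")
      case True
      then show ?thesis using main[of b a] mono[of b a] \<eta>[of b] ab by (simp add: algebra_simps)
    next
      case False
      then show ?thesis using main[of a b] mono[of a b] \<eta>[of a] ab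
        by (simp add: algebra_simps abs_minus_commute)
    qed
  qed
qed

lemma powr_add_le:
  fixes a b p :: real
  assumes "0 \<le> a" "0 \<le> b" "0 < p"
  shows "(a + b) powr p \<le> 2 powr p * (a powr p + b powr p)"
proof -
  have "(a + b) powr p \<le> (2 * max a b) powr p"
    using assms by (intro powr_mono2) auto
  also have "\<dots> = 2 powr p * max a b powr p"
    using assms by (simp add: powr_mult)
  also have "\<dots> \<le> 2 powr p * (a powr p + b powr p)"
    by (intro mult_left_mono) (auto simp: max_def)
  finally show ?thesis .
qed

text \<open>\<open>C\<close> is chosen before the graph and hence is common to all graphs with the
  same \<open>N\<close> and \<open>c\<close>. The positive and negative parts of
  \<open>f - m\<close>, for a median \<open>m\<close>, are supported on at most half of the
  vertices, so \<open>coarea\<close> applies to their p-th powers.\<close>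

lemma real_poincare:
  fixes N :: nat and c p :: real
  assumes "0 < N" "0 < c" "0 < p"
  shows "\<exists>C>0. \<forall>V E (f :: 'a \<Rightarrow> real). expander V E N c \<longrightarrow>
       (\<Sum>x\<in>V. \<Sum>y\<in>V. \<bar>f x - f y\<bar> powr p)
         \<le> C * real (card V) * expander.edge_sum V E (\<lambda>x y. \<bar>f x - f y\<bar> powr p)"
proof -
  \<comment> \<open>With c/(4N) the error terms from both ends of all edges add up to at most half
    of \<open>c * U\<close>, the left-hand side given by \<open>coarea\<close>.\<close>
  obtain K where K: "0 < K" and K_bound: "\<And>a b. 0 \<le> a \<Longrightarrow> 0 \<le> b \<Longrightarrow>
     \<bar>a powr p - b powr p\<bar> \<le> K * \<bar>a - b\<bar> powr p + c / (4 * N) * (a powr p + b powr p)"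
    using powr_diff_bound_ex[of p "c / (4 * N)"] assms by auto
  \<comment> \<open>Each of the two parts of \<open>f - m\<close> contributes 2K/c; the two
    variables of the double sum double the total, and the power of 2 comes from the triangle
    inequality through \<open>m\<close>.\<close>
  define C where "C = 2 powr p * (8 * K / c)"
  show ?thesis
  proof (intro exI[of _ C] conjI allI impI)
    show "0 < C" using K assms by (simp add: C_def)
    fix V :: "'a set" and E and f :: "'a \<Rightarrow> real"
    assume "expander V E N c"
    then interpret expander V E N c .
    obtain m where m: "2 * card {x\<in>V. m < f x} \<le> card V" "2 * card {x\<in>V. f x < m} \<le> card V"
      using ex_median[OF finite_V] .
    define S where "S = edge_sum (\<lambda>x y. \<bar>f x - f y\<bar> powr p)"
    have half: "(\<Sum>x\<in>V. u x powr p) \<le> 2 * K / c * S"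
      if u0: "\<And>x. 0 \<le> u x" and lip: "\<And>x y. \<bar>u x - u y\<bar> \<le> \<bar>f x - f y\<bar>"
        and supp: "2 * card {x\<in>V. 0 < u x} \<le> card V" for u
    proof -
      define U where "U = (\<Sum>x\<in>V. u x powr p)"
      have "{x\<in>V. 0 < u x powr p} = {x\<in>V. 0 < u x}"
        using u0 by (auto simp: order_less_le)
      then have "c * U \<le> edge_sum (\<lambda>x y. \<bar>u x powr p - u y powr p\<bar>)"
        unfolding U_def using supp by (intro coarea) auto
      also have "\<dots> \<le> edge_sum (\<lambda>x y. K * \<bar>f x - f y\<bar> powr p + c / (4 * N) * (u x powr p + u y powr p))"
      proof (rule edge_sum_mono)
        fix x y
        have "K * \<bar>u x - u y\<bar> powr p \<le> K * \<bar>f x - f y\<bar> powr p"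
          using lip K assms by (intro mult_left_mono powr_mono2) auto
        then show "\<bar>u x powr p - u y powr p\<bar> \<le> K * \<bar>f x - f y\<bar> powr p + c / (4 * N) * (u x powr p + u y powr p)"
          using K_bound[OF u0[of x] u0[of y]] by linarith
      qed
      also have "\<dots> = K * S + c / (4 * N) * (edge_sum (\<lambda>x y. u x powr p) + edge_sum (\<lambda>x y. u y powr p))"
        by (simp only: edge_sum_add edge_sum_cmult S_def)
      also have "\<dots> \<le> K * S + c / (4 * N) * (N * U + N * U)"
        unfolding U_def using assms
        by (intro add_left_mono mult_left_mono add_mono edge_sum_fst_le edge_sum_snd_le) auto
      also have "\<dots> = K * S + c / 2 * U"
        using N_pos by (simp add: field_simps)
      finally show ?thesis
        using c_pos by (simp add: U_def field_simps)
    qed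
    have "(\<Sum>x\<in>V. \<bar>f x - m\<bar> powr p)
        \<le> (\<Sum>x\<in>V. max (f x - m) 0 powr p + max (m - f x) 0 powr p)"
      by (intro sum_mono) (auto simp: max_def)
    also have "\<dots> \<le> 2 * K / c * S + 2 * K / c * S"
      unfolding sum.distrib
    proof (intro add_mono half)
      show "2 * card {x \<in> V. 0 < max (f x - m) 0} \<le> card V"
        "2 * card {x \<in> V. 0 < max (m - f x) 0} \<le> card V"
        using m by (simp_all add: less_max_iff_disj)
    qed (auto simp: max_def)
    finally have med: "(\<Sum>x\<in>V. \<bar>f x - m\<bar> powr p) \<le> 4 * K / c * S" by simp
    have "(\<Sum>x\<in>V. \<Sum>y\<in>V. \<bar>f x - f y\<bar> powr p)
        \<le> (\<Sum>x\<in>V. \<Sum>y\<in>V. 2 powr p * (\<bar>f x - m\<bar> powr p + \<bar>f y - m\<bar> powr p))"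
    proof (intro sum_mono)
      fix x y
      have "\<bar>f x - f y\<bar> powr p \<le> (\<bar>f x - m\<bar> + \<bar>f y - m\<bar>) powr p"
        using assms by (intro powr_mono2) auto
      also have "\<dots> \<le> 2 powr p * (\<bar>f x - m\<bar> powr p + \<bar>f y - m\<bar> powr p)"
        using assms by (intro powr_add_le) auto
      finally show "\<bar>f x - f y\<bar> powr p \<le> 2 powr p * (\<bar>f x - m\<bar> powr p + \<bar>f y - m\<bar> powr p)" .
    qed
    also have "\<dots> = 2 powr p * (2 * real (card V) * (\<Sum>x\<in>V. \<bar>f x - m\<bar> powr p))"
      by (simp add: sum.distrib sum_distrib_left[symmetric] algebra_simps)
    also have "\<dots> \<le> 2 powr p * (2 * real (card V) * (4 * K / c * S))"
      using med by (intro mult_left_mono) auto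
    also have "\<dots> = C * real (card V) * S"
      by (simp add: C_def)
    finally show "(\<Sum>x\<in>V. \<Sum>y\<in>V. \<bar>f x - f y\<bar> powr p) \<le> C * real (card V) * edge_sum (\<lambda>x y. \<bar>f x - f y\<bar> powr p)"
      by (simp add: S_def)
  qed
qed

text \<open>Real and imaginary parts are 1-Lipschitz, so their edge sums are bounded by that of
  \<open>f\<close>.\<close>

lemma complex_poincare:
  fixes N :: nat and c p :: real
  assumes "0 < N" "0 < c" "0 < p"
  shows "\<exists>C>0. \<forall>V E (f :: 'a \<Rightarrow> complex). expander V E N c \<longrightarrow>
       (\<Sum>x\<in>V. \<Sum>y\<in>V. norm (f x - f y) powr p)
         \<le> C * real (card V) * expander.edge_sum V E (\<lambda>x y. norm (f x - f y) powr p)"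
proof -
  obtain C where C: "0 < C" and real: "\<forall>V E (f :: 'a \<Rightarrow> real). expander V E N c \<longrightarrow>
       (\<Sum>x\<in>V. \<Sum>y\<in>V. \<bar>f x - f y\<bar> powr p)
         \<le> C * real (card V) * expander.edge_sum V E (\<lambda>x y. \<bar>f x - f y\<bar> powr p)"
    using real_poincare[OF assms, where ?'a = 'a] by blast
  show ?thesis
  proof (intro exI[of _ "2 powr p * (2 * C)"] conjI allI impI)
    show "0 < 2 powr p * (2 * C)" using C by simp
    fix V :: "'a set" and E and f :: "'a \<Rightarrow> complex"
    assume V: "expander V E N c"
    then interpret expander V E N c .
    define S where "S = edge_sum (\<lambda>x y. norm (f x - f y) powr p)"
    have part: "(\<Sum>x\<in>V. \<Sum>y\<in>V. \<bar>u x - u y\<bar> powr p) \<le> C * real (card V) * S"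
      if "\<And>x y. \<bar>u x - u y\<bar> \<le> norm (f x - f y)" for u
    proof -
      have "edge_sum (\<lambda>x y. \<bar>u x - u y\<bar> powr p) \<le> S"
        unfolding S_def using that assms by (intro edge_sum_mono powr_mono2) auto
      then have "C * real (card V) * edge_sum (\<lambda>x y. \<bar>u x - u y\<bar> powr p) \<le> C * real (card V) * S"
        using C by (intro mult_left_mono) auto
      then show ?thesis using real[rule_format, OF V, of u] by linarith
    qed
    have split: "norm z powr p \<le> 2 powr p * (\<bar>Re z\<bar> powr p + \<bar>Im z\<bar> powr p)" for z
    proof -
      have "norm z powr p \<le> (\<bar>Re z\<bar> + \<bar>Im z\<bar>) powr p"
        using assms cmod_le by (intro powr_mono2) auto
      also have "\<dots> \<le> 2 powr p * (\<bar>Re z\<bar> powr p + \<bar>Im z\<bar> powr p)"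
        using assms by (intro powr_add_le) auto
      finally show ?thesis .
    qed
    have "(\<Sum>x\<in>V. \<Sum>y\<in>V. norm (f x - f y) powr p) \<le> (\<Sum>x\<in>V. \<Sum>y\<in>V.
        2 powr p * (\<bar>Re (f x - f y)\<bar> powr p + \<bar>Im (f x - f y)\<bar> powr p))"
      by (intro sum_mono split)
    also have "\<dots> = 2 powr p * ((\<Sum>x\<in>V. \<Sum>y\<in>V. \<bar>Re (f x) - Re (f y)\<bar> powr p)
        + (\<Sum>x\<in>V. \<Sum>y\<in>V. \<bar>Im (f x) - Im (f y)\<bar> powr p))"
      by (simp add: sum.distrib flip: sum_distrib_left)
    also have "\<dots> \<le> 2 powr p * (C * real (card V) * S + C * real (card V) * S)"
      by (intro mult_left_mono add_mono part)
        (auto intro: order_trans[OF _ abs_Re_le_cmod] order_trans[OF _ abs_Im_le_cmod]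
          simp flip: minus_complex.sel)
    also have "\<dots> = 2 powr p * (2 * C) * real (card V) * S"
      by (simp add: algebra_simps)
    finally show "(\<Sum>x\<in>V. \<Sum>y\<in>V. norm (f x - f y) powr p)
        \<le> 2 powr p * (2 * C) * real (card V) * edge_sum (\<lambda>x y. norm (f x - f y) powr p)"
      by (simp add: S_def)
  qed
qed

section \<open>Maps into L^p\<close>

lemma Lp_dist_powr:
  assumes "0 < p"
  shows "Lp_dist M p f g powr p = (LINT w|M. norm (f w - g w) powr p)"
proof -
  have "0 \<le> (LINT w|M. norm (f w - g w) powr p)" by simp
  then show ?thesis
    using assms by (simp add: Lp_dist_def Lp_norm_def powr_powr)
qed

lemma Lp_fun_diff_integrable:
  fixes f g :: "'w \<Rightarrow> 'k::{real_normed_vector, second_countable_topology}"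
  assumes "0 < p" "f \<in> Lp_fun M p" "g \<in> Lp_fun M p"
  shows "integrable M (\<lambda>w. norm (f w - g w) powr p)"
proof (rule Bochner_Integration.integrable_bound)
  show "integrable M (\<lambda>w. 2 powr p * (norm (f w) powr p + norm (g w) powr p))"
    using assms by (intro integrable_mult_right Bochner_Integration.integrable_add) (auto simp: Lp_fun_def)
  have [measurable]: "f \<in> borel_measurable M" "g \<in> borel_measurable M"
    using assms by (auto simp: Lp_fun_def)
  show "(\<lambda>w. norm (f w - g w) powr p) \<in> borel_measurable M"
    by measurable
  show "AE w in M. norm (norm (f w - g w) powr p) \<le> norm (2 powr p * (norm (f w) powr p + norm (g w) powr p))"
  proof (rule AE_I2)
    fix w
    have "norm (f w - g w) powr p \<le> (norm (f w) + norm (g w)) powr p"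
      using assms norm_triangle_ineq4 by (intro powr_mono2) auto
    also have "\<dots> \<le> 2 powr p * (norm (f w) powr p + norm (g w) powr p)"
      using assms by (intro powr_add_le) auto
    finally show "norm (norm (f w - g w) powr p) \<le> norm (2 powr p * (norm (f w) powr p + norm (g w) powr p))"
      by simp
  qed
qed

text \<open>The p-th power of the distance is an integral over \<open>M\<close>, so the scalar
  inequality can be applied at each point and integrated. It is a hypothesis so that real and
  complex values share one proof.\<close>

lemma (in expander) Lp_poincare:
  fixes F :: "'a \<Rightarrow> 'w \<Rightarrow> 'k::{real_normed_vector, second_countable_topology}"
  assumes p: "0 < p" and C: "0 < C"
    and poincare: "\<And>f :: 'a \<Rightarrow> 'k. (\<Sum>x\<in>V. \<Sum>y\<in>V. norm (f x - f y) powr p)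
         \<le> C * real (card V) * edge_sum (\<lambda>x y. norm (f x - f y) powr p)"
    and F: "F \<in> V \<rightarrow> Lp_fun M p"
    and L: "\<And>x y. x \<in> V \<Longrightarrow> y \<in> V \<Longrightarrow> E x y \<Longrightarrow> Lp_dist M p (F x) (F y) \<le> L"
  shows "(\<Sum>x\<in>V. \<Sum>y\<in>V. Lp_dist M p (F x) (F y) powr p) \<le> C * real N * L powr p * (real (card V))\<^sup>2"
proof -
  let ?h = "\<lambda>x y w. norm (F x w - F y w) powr p"
  have int: "integrable M (?h x y)" if "x \<in> V" "y \<in> V" for x y
    using that F p by (intro Lp_fun_diff_integrable) auto
  have "(\<Sum>x\<in>V. \<Sum>y\<in>V. Lp_dist M p (F x) (F y) powr p) = (LINT w|M. (\<Sum>x\<in>V. \<Sum>y\<in>V. ?h x y w))"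
    using int p by (simp add: Lp_dist_powr)
  also have "\<dots> \<le> (LINT w|M. C * real (card V) * edge_sum (\<lambda>x y. ?h x y w))"
  proof (rule integral_mono)
    show "integrable M (\<lambda>w. \<Sum>x\<in>V. \<Sum>y\<in>V. ?h x y w)"
      by (intro Bochner_Integration.integrable_sum int)
    show "integrable M (\<lambda>w. C * real (card V) * edge_sum (\<lambda>x y. ?h x y w))"
      unfolding edge_sum_def
      by (intro integrable_mult_right Bochner_Integration.integrable_sum int) (auto dest: nbr_subset)
  qed (rule poincare)
  also have "\<dots> = C * real (card V) * edge_sum (\<lambda>x y. LINT w|M. ?h x y w)"
    using int by (simp add: edge_sum_def nbr_subset)
  also have "\<dots> = C * real (card V) * edge_sum (\<lambda>x y. Lp_dist M p (F x) (F y) powr p)"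
    using p by (simp add: Lp_dist_powr)
  also have "\<dots> \<le> C * real (card V) * edge_sum (\<lambda>x y. L powr p)"
    using C p L by (intro mult_left_mono edge_sum_mono powr_mono2) (auto simp: Lp_dist_def Lp_norm_def)
  also have "\<dots> \<le> C * real (card V) * (real N * (\<Sum>x\<in>V. L powr p))"
    using C by (intro mult_left_mono edge_sum_fst_le) auto
  also have "\<dots> = C * real N * L powr p * (real (card V))\<^sup>2"
    by (simp add: power2_eq_square)
  finally show ?thesis .
qed

section \<open>Random walks on expanders\<close>

context expander
begin

text \<open>The lazy random walk moves to each neighbour with probability 1/(2N), whatever the
  degree, and stays with probability at least 1/2.\<close>

definition walk :: "('a \<Rightarrow> 'v::real_vector) \<Rightarrow> 'a \<Rightarrow> 'v" where
  "walk f x = f x + (1 / (2 * real N)) *\<^sub>R (\<Sum>y\<in>nbr x. f y - f x)"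

definition avg :: "('a \<Rightarrow> 'v::real_vector) \<Rightarrow> 'v" where
  "avg f = (1 / real (card V)) *\<^sub>R (\<Sum>x\<in>V. f x)"

text \<open>For complex functions this is the operator T to which uniform curvature is applied; for
  functions with values in a Banach space the same term is its extension T \<otimes> id.\<close>

definition mixing :: "nat \<Rightarrow> ('a \<Rightarrow> 'v::real_vector) \<Rightarrow> 'a \<Rightarrow> 'v" where
  "mixing k f x = (1/2) *\<^sub>R ((walk ^^ k) f x - avg f)"

lemma walk_linear:
  assumes "linear \<phi>"
  shows "walk (\<lambda>x. \<phi> (f x)) = (\<lambda>x. \<phi> (walk f x))"
  unfolding walk_def
  by (simp add: linear_add[OF assms] linear_scale[OF assms] linear_sum[OF assms] linear_diff[OF assms])

lemma walk_iter_linear: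
  assumes "linear \<phi>"
  shows "(walk ^^ k) (\<lambda>x. \<phi> (f x)) = (\<lambda>x. \<phi> ((walk ^^ k) f x))"
  by (induction k) (simp_all add: walk_linear[OF assms])

text \<open>Taking for \<phi> the multiplication of a fixed vector by scalars shows that T \<otimes>
  id acts on elementary tensors as the vector-valued \<open>mixing k\<close>.\<close>

lemma mixing_linear:
  assumes "linear \<phi>"
  shows "mixing k (\<lambda>x. \<phi> (f x)) x = \<phi> (mixing k f x)"
  unfolding mixing_def avg_def walk_iter_linear[OF assms]
  by (simp add: linear_scale[OF assms] linear_sum[OF assms] linear_diff[OF assms])

lemma walk_sum: "walk (\<lambda>x. \<Sum>i\<in>I. f i x) = (\<lambda>x. \<Sum>i\<in>I. walk (f i) x)"
proof
  fix x
  have "(\<Sum>y\<in>nbr x. \<Sum>i\<in>I. f i y - f i x) = (\<Sum>i\<in>I. \<Sum>y\<in>nbr x. f i y - f i x)"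
    by (rule sum.swap)
  then show "walk (\<lambda>x. \<Sum>i\<in>I. f i x) x = (\<Sum>i\<in>I. walk (f i) x)"
    by (simp add: walk_def sum.distrib scaleR_sum_right flip: sum_subtractf)
qed

lemma walk_iter_sum: "(walk ^^ k) (\<lambda>x. \<Sum>i\<in>I. f i x) = (\<lambda>x. \<Sum>i\<in>I. (walk ^^ k) (f i) x)"
  by (induction k) (simp_all add: walk_sum)

lemma mixing_sum: "mixing k (\<lambda>x. \<Sum>i\<in>I. f i x) x = (\<Sum>i\<in>I. mixing k (f i) x)"
proof -
  have "(\<Sum>x\<in>V. \<Sum>i\<in>I. f i x) = (\<Sum>i\<in>I. \<Sum>x\<in>V. f i x)"
    by (rule sum.swap)
  then show ?thesis
    by (simp add: mixing_def avg_def walk_iter_sum sum_subtractf flip: scaleR_sum_right)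
qed

lemma walk_add: "walk (\<lambda>x. f x + g x) = (\<lambda>x. walk f x + walk g x)"
  by (simp add: walk_def fun_eq_iff add_diff_add sum.distrib scaleR_add_right)

lemma walk_iter_add: "(walk ^^ k) (\<lambda>x. f x + g x) = (\<lambda>x. (walk ^^ k) f x + (walk ^^ k) g x)"
  by (induction k) (simp_all add: walk_add)

lemma mixing_add: "mixing k (\<lambda>x. f x + g x) x = mixing k f x + mixing k g x"
  by (simp add: mixing_def avg_def walk_iter_add sum.distrib scaleR_add_right algebra_simps)

lemma walk_iter_uminus: "(walk ^^ k) (\<lambda>x. - f x) = (\<lambda>x. - (walk ^^ k) f x)"
  by (rule walk_iter_linear) (simp add: linear_iff)

lemma walk_iter_diff: "(walk ^^ k) (\<lambda>x. f x - g x) = (\<lambda>x. (walk ^^ k) f x - (walk ^^ k) g x)"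
  using walk_iter_add[of k f "\<lambda>x. - g x"] by (simp add: walk_iter_uminus)

lemma walk_iter_const: "(walk ^^ k) (\<lambda>x. v) = (\<lambda>x. v)"
  by (induction k) (simp_all add: walk_def)

lemma avg_const: "avg (\<lambda>x. v) = v"
  using card_V_pos by (simp add: avg_def sum_constant_scaleR)

lemma avg_diff: "avg (\<lambda>x. f x - g x) = avg f - avg g"
  by (simp add: avg_def sum_subtractf scaleR_diff_right)

text \<open>The increment \<open>f y - f x\<close> changes sign when an edge is reversed, while
  \<open>edge_sum\<close> is invariant under reversal.\<close>

lemma sum_walk: "(\<Sum>x\<in>V. walk f x) = (\<Sum>x\<in>V. f x)"
proof -
  have "edge_sum (\<lambda>x y. f y - f x) + edge_sum (\<lambda>x y. f y - f x) =
      edge_sum (\<lambda>x y. f x - f y) + edge_sum (\<lambda>x y. f y - f x)"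
    using edge_sum_swap[of "\<lambda>x y. f x - f y"] by simp
  also have "\<dots> = 0"
    by (simp flip: edge_sum_add) (simp add: edge_sum_def)
  finally have "2 *\<^sub>R edge_sum (\<lambda>x y. f y - f x) = 0"
    by (simp add: scaleR_2)
  then show ?thesis
    by (simp add: walk_def sum.distrib edge_sum_def flip: scaleR_sum_right)
qed

lemma avg_walk_iter: "avg ((walk ^^ k) f) = avg f"
  by (induction k) (simp_all add: avg_def sum_walk)

section \<open>Contraction in the sup norm and the l^1 norm\<close>

lemma norm_walk_le:
  fixes f :: "'a \<Rightarrow> 'v::real_normed_vector"
  assumes "x \<in> V"
  shows "norm (walk f x) \<le> walk (\<lambda>x. norm (f x)) x"
proof -
  \<comment> \<open>In this form all coefficients are nonnegative, as there are at most
    \<open>N\<close> neighbours.\<close>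
  have w: "walk g x = (1 - real (card (nbr x)) / (2 * real N)) *\<^sub>R g x
      + (1 / (2 * real N)) *\<^sub>R (\<Sum>y\<in>nbr x. g y)" for g :: "'a \<Rightarrow> 'u::real_vector"
    by (simp add: walk_def sum_subtractf sum_constant_scaleR algebra_simps)
  have "0 \<le> 1 - real (card (nbr x)) / (2 * real N)"
    using card_nbr[OF assms] N_pos by (simp add: field_simps)
  then show ?thesis
    unfolding w
    by (intro norm_triangle_le add_mono) (auto simp: norm_sum mult_left_mono divide_right_mono)
qed

text \<open>Positivity comes out of \<open>norm_walk_le\<close>: for h = g - f, nonnegative on
  \<open>V\<close>, the upper bound there is \<open>walk h\<close> itself, and it dominates an
  absolute value.\<close>

lemma walk_mono:
  fixes f :: "'a \<Rightarrow> real"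
  assumes "x \<in> V" "\<And>x. x \<in> V \<Longrightarrow> f x \<le> g x"
  shows "walk f x \<le> walk g x"
proof -
  have "0 \<le> walk (\<lambda>x. \<bar>g x - f x\<bar>) x"
    using norm_walk_le[OF assms(1), of "\<lambda>x. g x - f x"] 
    unfolding real_norm_def by (rule order_trans[OF abs_ge_zero])
  also have "walk (\<lambda>x. \<bar>g x - f x\<bar>) x = walk (\<lambda>x. g x - f x) x"
    using assms by (auto simp: walk_def intro!: sum.cong dest: nbr_subset)
  finally show ?thesis
    using walk_iter_diff[of 1 g f] by (simp add: fun_eq_iff)
qed

lemma norm_walk_bounded:
  fixes f :: "'a \<Rightarrow> 'v::real_normed_vector"
  assumes "\<And>x. x \<in> V \<Longrightarrow> norm (f x) \<le> r" "x \<in> V"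
  shows "norm (walk f x) \<le> r"
proof -
  have "norm (walk f x) \<le> walk (\<lambda>x. norm (f x)) x"
    by (rule norm_walk_le[OF assms(2)])
  also have "\<dots> \<le> walk (\<lambda>x. r) x"
    using assms by (intro walk_mono)
  also have "\<dots> = r" by (simp add: walk_def)
  finally show ?thesis .
qed

lemma norm_walk_iter_bounded:
  fixes f :: "'a \<Rightarrow> 'v::real_normed_vector"
  assumes "\<And>x. x \<in> V \<Longrightarrow> norm (f x) \<le> r" "x \<in> V"
  shows "norm ((walk ^^ k) f x) \<le> r"
  using assms(2) by (induction k arbitrary: x) (auto intro: assms(1) norm_walk_bounded)

lemma sum_norm_walk_le:
  fixes f :: "'a \<Rightarrow> 'v::real_normed_vector"
  shows "(\<Sum>x\<in>V. norm (walk f x)) \<le> (\<Sum>x\<in>V. norm (f x))"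
  unfolding sum_walk[of "\<lambda>x. norm (f x)", symmetric] by (intro sum_mono norm_walk_le)

lemma sum_norm_walk_iter_le:
  fixes f :: "'a \<Rightarrow> 'v::real_normed_vector"
  shows "(\<Sum>x\<in>V. norm ((walk ^^ k) f x)) \<le> (\<Sum>x\<in>V. norm (f x))"
  by (induction k) (auto intro: order_trans[OF sum_norm_walk_le])

lemma norm_avg_bounded:
  fixes f :: "'a \<Rightarrow> 'v::real_normed_vector"
  assumes "\<And>x. x \<in> V \<Longrightarrow> norm (f x) \<le> r"
  shows "norm (avg f) \<le> r"
proof -
  have "norm (\<Sum>x\<in>V. f x) \<le> real (card V) * r"
    using assms by (rule sum_norm_bound)
  then show ?thesis
    using card_V_pos by (simp add: avg_def field_simps)
qed

lemma norm_mixing_bounded: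
  fixes f :: "'a \<Rightarrow> 'v::real_normed_vector"
  assumes "\<And>x. x \<in> V \<Longrightarrow> norm (f x) \<le> r" "x \<in> V"
  shows "norm (mixing k f x) \<le> r"
proof -
  have "norm ((walk ^^ k) f x) \<le> r" "norm (avg f) \<le> r"
    by (rule norm_walk_iter_bounded norm_avg_bounded; fact assms)+
  then show ?thesis
    using norm_triangle_ineq4[of "(walk ^^ k) f x" "avg f"] by (simp add: mixing_def)
qed

lemma sum_norm_mixing_le:
  fixes f :: "'a \<Rightarrow> 'v::real_normed_vector"
  shows "(\<Sum>x\<in>V. norm (mixing k f x)) \<le> (\<Sum>x\<in>V. norm (f x))"
proof -
  have "(\<Sum>x\<in>V. norm (mixing k f x)) \<le> (\<Sum>x\<in>V. 1/2 * (norm ((walk ^^ k) f x) + norm (avg f)))"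
    by (intro sum_mono) (simp add: mixing_def norm_triangle_ineq4)
  also have "\<dots> = 1/2 * ((\<Sum>x\<in>V. norm ((walk ^^ k) f x)) + norm (\<Sum>x\<in>V. f x))"
    using card_V_pos by (simp add: sum.distrib avg_def flip: sum_distrib_left sum_divide_distrib)
  also have "\<dots> \<le> 1/2 * ((\<Sum>x\<in>V. norm (f x)) + (\<Sum>x\<in>V. norm (f x)))"
    by (intro mult_left_mono add_mono sum_norm_walk_iter_le norm_sum) auto
  finally show ?thesis by simp
qed

text \<open>The increments telescope: each is an iterate of the walk applied to
  \<open>walk f - f\<close>, and iterating does not increase the sup norm.\<close>

lemma walk_iter_displacement:
  fixes f :: "'a \<Rightarrow> 'v::real_normed_vector"
  assumes L: "\<And>x y. x \<in> V \<Longrightarrow> y \<in> V \<Longrightarrow> E x y \<Longrightarrow> norm (f x - f y) \<le> L" and "0 \<le> L" "x \<in> V"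
  shows "norm ((walk ^^ k) f x - f x) \<le> real k * L"
proof (induction k)
  case (Suc k)
  have step: "norm (walk f x - f x) \<le> L" if "x \<in> V" for x
  proof -
    have "norm (\<Sum>y\<in>nbr x. f y - f x) \<le> real (card (nbr x)) * L"
      using L[OF that] by (intro sum_norm_bound) (auto simp: nbr_def norm_minus_commute)
    also have "\<dots> \<le> real N * L"
      using card_nbr[OF that] \<open>0 \<le> L\<close> by (intro mult_right_mono) auto
    finally have "1 / (2 * real N) * norm (\<Sum>y\<in>nbr x. f y - f x) \<le> 1 / (2 * real N) * (real N * L)"
      by (intro mult_left_mono) auto
    then show ?thesis
      using N_pos \<open>0 \<le> L\<close> by (simp add: walk_def)
  qed
  have "norm ((walk ^^ k) (\<lambda>x. walk f x - f x) x) \<le> L"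
    using step \<open>x \<in> V\<close> by (intro norm_walk_iter_bounded)
  then have "norm ((walk ^^ Suc k) f x - (walk ^^ k) f x) \<le> L"
    by (simp add: walk_iter_diff funpow_swap1)
  then show ?case
    using Suc norm_triangle_ineq[of "(walk ^^ Suc k) f x - (walk ^^ k) f x" "(walk ^^ k) f x - f x"]
    by (simp add: algebra_simps)
qed simp

section \<open>The spectral gap in l^2\<close>

lemma sum_norm2_walk_le:
  fixes f :: "'a \<Rightarrow> 'v::real_inner"
  shows "(\<Sum>x\<in>V. (norm (walk f x))\<^sup>2) \<le>
    (\<Sum>x\<in>V. (norm (f x))\<^sup>2) - 1 / (4 * real N) * edge_sum (\<lambda>x y. (norm (f x - f y))\<^sup>2)"
proof -
  define L where "L x = (\<Sum>y\<in>nbr x. f y - f x)" for x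
  define Q where "Q = edge_sum (\<lambda>x y. (norm (f x - f y))\<^sup>2)"
  have Q': "Q = (\<Sum>x\<in>V. \<Sum>y\<in>nbr x. (norm (f y - f x))\<^sup>2)"
    by (simp add: Q_def edge_sum_def norm_minus_commute)
  \<comment> \<open>Summation by parts: adding the terms for the two directions of an edge gives
    minus the squared difference.\<close>
  have cross: "2 * (\<Sum>x\<in>V. f x \<bullet> L x) = - Q"
  proof -
    have "(\<Sum>x\<in>V. f x \<bullet> L x) = edge_sum (\<lambda>x y. f x \<bullet> (f y - f x))"
      by (simp add: L_def edge_sum_def inner_sum_right)
    moreover have "(\<Sum>x\<in>V. f x \<bullet> L x) = edge_sum (\<lambda>x y. f y \<bullet> (f x - f y))"
      using calculation edge_sum_swap[of "\<lambda>x y. f x \<bullet> (f y - f x)"] by simp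
    ultimately have "2 * (\<Sum>x\<in>V. f x \<bullet> L x) = edge_sum (\<lambda>x y. f x \<bullet> (f y - f x) + f y \<bullet> (f x - f y))"
      by (simp add: edge_sum_add)
    also have "\<dots> = edge_sum (\<lambda>x y. (-1) * (norm (f x - f y))\<^sup>2)"
      by (rule arg_cong[of _ _ edge_sum])
        (simp add: fun_eq_iff power2_norm_eq_inner inner_diff inner_commute algebra_simps)
    also have "\<dots> = - Q"
      unfolding Q_def edge_sum_cmult by simp
    finally show ?thesis .
  qed
  have "(\<Sum>x\<in>V. (norm (L x))\<^sup>2) \<le> (\<Sum>x\<in>V. real N * (\<Sum>y\<in>nbr x. (norm (f y - f x))\<^sup>2))"
  proof (rule sum_mono)
    fix x assume "x \<in> V"
    have "(norm (L x))\<^sup>2 \<le> (\<Sum>y\<in>nbr x. norm (f y - f x))\<^sup>2"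
      unfolding L_def by (intro power_mono norm_sum) auto
    also have "\<dots> \<le> (\<Sum>y\<in>nbr x. (norm (f y - f x))\<^sup>2) * real (card (nbr x))"
      by (rule sum_squared_le_sum_of_squares)
    also have "\<dots> \<le> (\<Sum>y\<in>nbr x. (norm (f y - f x))\<^sup>2) * real N"
      using card_nbr[OF \<open>x \<in> V\<close>] by (intro mult_left_mono) (auto intro: sum_nonneg)
    finally show "(norm (L x))\<^sup>2 \<le> real N * (\<Sum>y\<in>nbr x. (norm (f y - f x))\<^sup>2)"
      by (simp add: mult.commute)
  qed
  also have "\<dots> = real N * Q"
    by (simp add: Q' sum_distrib_left)
  finally have lap: "(\<Sum>x\<in>V. (norm (L x))\<^sup>2) \<le> real N * Q" .
  \<comment> \<open>Since a^2 N = a/2, the quadratic term takes back only half of the decrease a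
    Q.\<close>
  define a where "a = 1 / (2 * real N)"
  have "(norm (walk f x))\<^sup>2 = (norm (f x))\<^sup>2 + (2 * a) * (f x \<bullet> L x) + a\<^sup>2 * (norm (L x))\<^sup>2" for x
    unfolding walk_def L_def[symmetric] a_def[symmetric] power2_norm_eq_inner
    by (simp add: inner_add inner_commute power2_eq_square)
  then have "(\<Sum>x\<in>V. (norm (walk f x))\<^sup>2) = (\<Sum>x\<in>V. (norm (f x))\<^sup>2) + (2 * a) * (\<Sum>x\<in>V. f x \<bullet> L x)
      + a\<^sup>2 * (\<Sum>x\<in>V. (norm (L x))\<^sup>2)"
    by (simp only: sum.distrib sum_distrib_left)
  also have "\<dots> \<le> (\<Sum>x\<in>V. (norm (f x))\<^sup>2) + (2 * a) * (\<Sum>x\<in>V. f x \<bullet> L x) + a\<^sup>2 * (real N * Q)"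
    by (intro add_left_mono mult_left_mono lap) auto
  also have "(2 * a) * (\<Sum>x\<in>V. f x \<bullet> L x) = - (a * Q)"
    using arg_cong[OF cross, of "\<lambda>t. a * t"] by simp
  also have "a\<^sup>2 * (real N * Q) = a * Q / 2"
    using N_pos by (simp add: a_def power2_eq_square)
  also have "(\<Sum>x\<in>V. (norm (f x))\<^sup>2) + - (a * Q) + a * Q / 2
      = (\<Sum>x\<in>V. (norm (f x))\<^sup>2) - 1 / (4 * real N) * Q"
    by (simp add: a_def)
  finally show ?thesis by (simp add: Q_def)
qed

lemma sum_norm2_diff:
  fixes f :: "'a \<Rightarrow> 'v::real_inner"
  shows "(\<Sum>x\<in>V. \<Sum>y\<in>V. (norm (f x - f y))\<^sup>2) =
    2 * real (card V) * (\<Sum>x\<in>V. (norm (f x))\<^sup>2) - 2 * (norm (\<Sum>x\<in>V. f x))\<^sup>2"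
proof -
  have "(norm (f x - f y))\<^sup>2 = (norm (f x))\<^sup>2 + (norm (f y))\<^sup>2 - 2 * (f x \<bullet> f y)" for x y
    unfolding power2_norm_eq_inner by (simp add: inner_diff inner_commute)
  moreover have "(norm (\<Sum>x\<in>V. f x))\<^sup>2 = (\<Sum>x\<in>V. \<Sum>y\<in>V. f x \<bullet> f y)"
    unfolding power2_norm_eq_inner inner_sum_left inner_sum_right by (rule sum.swap)
  ultimately show ?thesis
    by (simp add: sum.distrib sum_subtractf flip: sum_distrib_left)
qed

lemma sum_norm2_sub_avg_le:
  fixes f :: "'a \<Rightarrow> 'v::real_inner"
  shows "(\<Sum>x\<in>V. (norm (f x - avg f))\<^sup>2) \<le> (\<Sum>x\<in>V. (norm (f x))\<^sup>2)"
proof -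
  have "(\<Sum>x\<in>V. f x) = real (card V) *\<^sub>R avg f"
    using card_V_pos by (simp add: avg_def)
  then have "(\<Sum>x\<in>V. f x \<bullet> avg f) = real (card V) * (norm (avg f))\<^sup>2"
    by (simp add: power2_norm_eq_inner flip: inner_sum_left)
  moreover have "(norm (f x - avg f))\<^sup>2 = (norm (f x))\<^sup>2 + (norm (avg f))\<^sup>2 - 2 * (f x \<bullet> avg f)" for x
    unfolding power2_norm_eq_inner by (simp add: inner_diff inner_commute)
  ultimately have "(\<Sum>x\<in>V. (norm (f x - avg f))\<^sup>2)
      = (\<Sum>x\<in>V. (norm (f x))\<^sup>2) - real (card V) * (norm (avg f))\<^sup>2"
    by (simp add: sum.distrib sum_subtractf flip: sum_distrib_left)
  then show ?thesis by simp
qed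

context
  fixes C :: real
  assumes C_pos: "0 < C"
    and poincare: "\<And>f :: 'a \<Rightarrow> 'v::real_inner. (\<Sum>x\<in>V. \<Sum>y\<in>V. (norm (f x - f y))\<^sup>2)
      \<le> C * real (card V) * edge_sum (\<lambda>x y. (norm (f x - f y))\<^sup>2)"
begin

text \<open>For mean-zero \<open>f\<close> the double sum in the Poincare inequality is 2 |V| times
  the squared norm, so the energy lost in one step is at least a fixed proportion of the squared
  norm.\<close>

lemma walk_contracts:
  fixes f :: "'a \<Rightarrow> 'v"
  assumes "avg f = 0"
  shows "(\<Sum>x\<in>V. (norm (walk f x))\<^sup>2) \<le> (1 - 1 / (2 * real N * C)) * (\<Sum>x\<in>V. (norm (f x))\<^sup>2)"
proof -
  define Q where "Q = edge_sum (\<lambda>x y. (norm (f x - f y))\<^sup>2)"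
  define S where "S = (\<Sum>x\<in>V. (norm (f x))\<^sup>2)"
  have "(\<Sum>x\<in>V. f x) = 0" using assms card_V_pos by (simp add: avg_def)
  then have "real (card V) * (2 * S) \<le> real (card V) * (C * Q)"
    using poincare[of f] sum_norm2_diff[of f] by (simp add: S_def Q_def algebra_simps)
  then have "2 * S \<le> C * Q" using card_V_pos by simp
  then have "1 / (4 * real N * C) * (2 * S) \<le> 1 / (4 * real N * C) * (C * Q)"
    using C_pos by (intro mult_left_mono) auto
  then have "1 / (2 * real N * C) * S \<le> 1 / (4 * real N) * Q"
    using C_pos N_pos by (simp add: field_simps)
  then show ?thesis
    using sum_norm2_walk_le[of f] by (simp add: S_def Q_def algebra_simps)
qed

text \<open>The induction multiplies by the factor, which is not known to be nonnegative;
  \<open>q\<close> is a nonnegative majorant of it.\<close>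

lemma walk_iter_contracts:
  fixes f :: "'a \<Rightarrow> 'v"
  assumes "avg f = 0" "1 - 1 / (2 * real N * C) \<le> q" "0 \<le> q"
  shows "(\<Sum>x\<in>V. (norm ((walk ^^ k) f x))\<^sup>2) \<le> q ^ k * (\<Sum>x\<in>V. (norm (f x))\<^sup>2)"
proof (induction k)
  case (Suc k)
  have "(\<Sum>x\<in>V. (norm ((walk ^^ Suc k) f x))\<^sup>2)
      \<le> (1 - 1 / (2 * real N * C)) * (\<Sum>x\<in>V. (norm ((walk ^^ k) f x))\<^sup>2)"
    using walk_contracts[of "(walk ^^ k) f"] assms(1) by (simp add: avg_walk_iter)
  also have "\<dots> \<le> q * (\<Sum>x\<in>V. (norm ((walk ^^ k) f x))\<^sup>2)"
    using assms by (intro mult_right_mono) (auto intro: sum_nonneg)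
  also have "\<dots> \<le> q * (q ^ k * (\<Sum>x\<in>V. (norm (f x))\<^sup>2))"
    using assms Suc by (intro mult_left_mono) auto
  finally show ?case by simp
qed simp

text \<open>The walk fixes constants, so \<open>mixing k f\<close> is half of the k-step walk of
  \<open>f - avg f\<close>, and centring does not increase the norm.\<close>

lemma sum_norm2_mixing_le:
  fixes f :: "'a \<Rightarrow> 'v"
  assumes "1 - 1 / (2 * real N * C) \<le> q" "0 \<le> q"
  shows "(\<Sum>x\<in>V. (norm (mixing k f x))\<^sup>2) \<le> q ^ k / 4 * (\<Sum>x\<in>V. (norm (f x))\<^sup>2)"
proof -
  have "(\<Sum>x\<in>V. (norm (mixing k f x))\<^sup>2) = 1/4 * (\<Sum>x\<in>V. (norm ((walk ^^ k) (\<lambda>x. f x - avg f) x))\<^sup>2)"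
    by (simp add: mixing_def walk_iter_diff walk_iter_const power_divide sum_divide_distrib)
  also have "\<dots> \<le> 1/4 * (q ^ k * (\<Sum>x\<in>V. (norm (f x - avg f))\<^sup>2))"
    using assms by (intro mult_left_mono walk_iter_contracts) (auto simp: avg_diff avg_const)
  also have "\<dots> \<le> 1/4 * (q ^ k * (\<Sum>x\<in>V. (norm (f x))\<^sup>2))"
    using assms by (intro mult_left_mono sum_norm2_sub_avg_le) auto
  finally show ?thesis by simp
qed

end

end

section \<open>Poincare inequalities for uniformly curved spaces\<close>

lemma Lp_fun_count_space:
  fixes S :: "'w set"
  assumes "finite S"
  shows "(f :: 'w \<Rightarrow> 'k::{real_normed_vector, second_countable_topology}) \<in> Lp_fun (count_space S) p"
  using assms by (auto simp: Lp_fun_def intro!: integrable_count_space)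

lemma L2_norm_count_space:
  assumes "finite S"
  shows "Lp_norm (count_space S) 2 f = sqrt (\<Sum>x\<in>S. (norm (f x))\<^sup>2)"
  using assms by (simp add: Lp_norm_def lebesgue_integral_count_space_finite powr_half_sqrt sum_nonneg)

lemma L1_norm_count_space:
  assumes "finite S"
  shows "Lp_norm (count_space S) 1 f = (\<Sum>x\<in>S. norm (f x))"
  using assms by (simp add: Lp_norm_def lebesgue_integral_count_space_finite sum_nonneg)

lemma (in expander) mixing_L2_operator_bound:
  assumes C: "0 < C"
    and poincare: "\<And>f :: 'a \<Rightarrow> complex. (\<Sum>x\<in>V. \<Sum>y\<in>V. (norm (f x - f y))\<^sup>2)
      \<le> C * real (card V) * edge_sum (\<lambda>x y. (norm (f x - f y))\<^sup>2)"
    and q: "1 - 1 / (2 * real N * C) \<le> q" "0 \<le> q"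
  shows "L2_operator_bound (count_space V) (sqrt q ^ k / 2) (mixing k)"
  unfolding L2_operator_bound_def
proof (intro conjI ballI allI)
  show "mixing k \<in> Lp_fun (count_space V) 2 \<rightarrow> Lp_fun (count_space V) 2"
    using Lp_fun_count_space[OF finite_V] by blast
next
  fix f g :: "'a \<Rightarrow> complex" and a b :: complex
  have "linear (\<lambda>z. a * z)" for a :: complex
    by (simp add: linear_iff algebra_simps)
  then show "AE x in count_space V. mixing k (\<lambda>y. a * f y + b * g y) x = a * mixing k f x + b * mixing k g x"
    by (simp add: mixing_add mixing_linear)
next
  fix f :: "'a \<Rightarrow> complex"
  have "sqrt (\<Sum>x\<in>V. (norm (mixing k f x))\<^sup>2) \<le> sqrt ((sqrt q ^ k / 2)\<^sup>2 * (\<Sum>x\<in>V. (norm (f x))\<^sup>2))"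
    using sum_norm2_mixing_le[OF C poincare q, of k f] q
    by (simp add: power_divide flip: power_mult power_even_eq) (simp add: power_mult_distrib mult.commute[of k] power_mult)
  also have "\<dots> = sqrt q ^ k / 2 * sqrt (\<Sum>x\<in>V. (norm (f x))\<^sup>2)"
    using q by (simp add: real_sqrt_mult)
  finally show "Lp_norm (count_space V) 2 (mixing k f) \<le> sqrt q ^ k / 2 * Lp_norm (count_space V) 2 f"
    by (simp add: L2_norm_count_space finite_V)
qed

lemma (in expander) mixing_L1_contractive: "L1_contractive (count_space V) (mixing k)"
  unfolding L1_contractive_def
  by (simp add: L1_norm_count_space Lp_fun_count_space finite_V sum_norm_mixing_le)

lemma (in expander) mixing_Linf_contractive: "Linf_contractive (count_space V) (mixing k)"
  unfolding Linf_contractive_def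
proof
  fix f :: "'a \<Rightarrow> complex"
  define z where "z = Linf_norm (count_space V) f"
  have z: "ereal (norm (f x)) \<le> z" if "x \<in> V" for x
    using esssup_AE[of "\<lambda>x. ereal (norm (f x))" "count_space V"] that
    by (simp add: AE_count_space z_def Linf_norm_def)
  have "ereal (norm (mixing k f x)) \<le> z" if "x \<in> V" for x
  proof (cases z)
    case (real r)
    then show ?thesis
      using z that by (auto intro: norm_mixing_bounded)
  qed (use z that in auto)
  then have "esssup (count_space V) (\<lambda>x. ereal (norm (mixing k f x))) \<le> z"
    by (intro esssup_I) (auto simp: AE_count_space)
  then show "Linf_norm (count_space V) (mixing k f) \<le> Linf_norm (count_space V) f"
    by (simp add: Linf_norm_def z_def)
qed

lemma linear_scaleC_left: "linear (\<lambda>a. scaleC a (x :: 'e::complex_banach))"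
proof
  fix r :: real and a b :: complex
  show "scaleC (a + b) x = scaleC a x + scaleC b x" by (rule scaleC_add_left)
  show "scaleC (r *\<^sub>R a) x = r *\<^sub>R scaleC a x"
    by (simp add: scaleR_conv_of_real flip: scaleC_scaleC scaleC_of_real)
qed

text \<open>On a finite set every function is a finite sum of point masses times its values, so a
  bound on sums of elementary tensors reaches all of them.\<close>

lemma (in expander) tensor_bound_mixing:
  fixes G :: "'a \<Rightarrow> 'e::complex_banach"
  assumes "tensor_id_bound TYPE('e) (count_space V) (mixing k) B"
  shows "sqrt (\<Sum>x\<in>V. (norm (mixing k G x))\<^sup>2) \<le> B * sqrt (\<Sum>x\<in>V. (norm (G x))\<^sup>2)"
proof -
  \<comment> \<open>The sum of point masses vanishes off \<open>V\<close>, so it reproduces the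
    truncation of \<open>G\<close>; on \<open>V\<close> the walk sees only values on
    \<open>V\<close>.\<close>
  define G0 where "G0 x = (if x \<in> V then G x else 0)" for x
  obtain e where e: "bij_betw e {..<card V} V"
    using ex_bij_betw_nat_finite[OF finite_V] by (auto simp: atLeast0LessThan)
  have zero: "scaleC 0 x = 0" and one: "scaleC 1 x = x" for x :: 'e
    using scaleC_of_real[of 0 x] scaleC_of_real[of 1 x] by auto
  have G0: "(\<Sum>i<card V. scaleC (of_bool (x = e i)) (G0 (e i))) = G0 x" for x
  proof -
    have "(\<Sum>i<card V. scaleC (of_bool (x = e i)) (G0 (e i))) = (\<Sum>y\<in>V. scaleC (of_bool (x = y)) (G0 y))"
      by (rule sum.reindex_bij_betw[OF e])
    also have "\<dots> = (\<Sum>y\<in>V. if x = y then G0 y else 0)"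
      by (intro sum.cong) (auto simp: zero one)
    also have "\<dots> = G0 x"
      using finite_V by (simp add: G0_def)
    finally show ?thesis .
  qed
  have "(\<Sum>i<card V. scaleC (mixing k (\<lambda>x. of_bool (x = e i)) x) (G0 (e i)))
      = mixing k (\<lambda>x. \<Sum>i<card V. scaleC (of_bool (x = e i)) (G0 (e i))) x" for x
    unfolding mixing_sum by (simp add: mixing_linear[OF linear_scaleC_left])
  then have "Lp_norm (count_space V) 2 (mixing k G0) \<le> B * Lp_norm (count_space V) 2 G0"
    using assms[unfolded tensor_id_bound_def, rule_format, of "card V" "\<lambda>i x. of_bool (x = e i)" "\<lambda>i. G0 (e i)"]
    by (simp add: Lp_fun_count_space finite_V G0)
  moreover have walk_cong: "walk f x = walk f' x" if "\<And>x. x \<in> V \<Longrightarrow> f x = f' x" "x \<in> V"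
    for f f' :: "'a \<Rightarrow> 'e" and x
    using that by (simp add: walk_def nbr_subset)
  have "(walk ^^ j) G0 x = (walk ^^ j) G x" if "x \<in> V" for j x
    using that by (induction j arbitrary: x) (auto simp: G0_def intro: walk_cong)
  then have "mixing k G0 x = mixing k G x" if "x \<in> V" for x
    using that by (simp add: mixing_def avg_def G0_def)
  ultimately show ?thesis
    by (simp add: L2_norm_count_space finite_V G0_def)
qed

text \<open>Once \<open>\<Delta>\<close> brings the norm of the \<open>k\<close>-step walk on mean-zero vectors below 1/2, a mean-zero
  \<open>G\<close> is comparable to its displacement under \<open>k\<close> steps.\<close>

lemma uniformly_curved_poincare:
  fixes N :: nat and c L :: real
  assumes curved: "uniformly_curved TYPE('e::complex_banach)" and "0 < N" "0 < c" "0 \<le> L"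
  shows "\<exists>K. \<forall>(V :: real set) E (F :: real \<Rightarrow> 'e). expander V E N c \<longrightarrow>
    (\<forall>x\<in>V. \<forall>y\<in>V. E x y \<longrightarrow> dist (F x) (F y) \<le> L) \<longrightarrow>
    (\<Sum>x\<in>V. \<Sum>y\<in>V. dist (F x) (F y) powr 2) \<le> K * (real (card V))\<^sup>2"
proof -
  obtain C where C: "0 < C" and poincare: "\<forall>V E (f :: real \<Rightarrow> complex). expander V E N c \<longrightarrow>
       (\<Sum>x\<in>V. \<Sum>y\<in>V. norm (f x - f y) powr 2)
         \<le> C * real (card V) * expander.edge_sum V E (\<lambda>x y. norm (f x - f y) powr 2)"
    using complex_poincare[OF assms(2,3), of 2, where ?'a = real] by auto
  \<comment> \<open>The maximum keeps \<open>q\<close> positive, so that the norms below tend to 0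
    through positive values.\<close>
  define q where "q = max (1 - 1 / (2 * real N * C)) (1/2)"
  have q: "1 - 1 / (2 * real N * C) \<le> q" "0 < q" "q < 1"
    using C assms(2) by (auto simp: q_def)
  obtain \<Delta> where \<Delta>: "(\<Delta> \<longlongrightarrow> 0) (at_right 0)"
    and bound: "\<And>\<epsilon> (M :: real measure) T. 0 < \<epsilon> \<Longrightarrow> L2_operator_bound M \<epsilon> T \<Longrightarrow>
        L1_contractive M T \<Longrightarrow> Linf_contractive M T \<Longrightarrow> tensor_id_bound TYPE('e) M T (\<Delta> \<epsilon>)"
    using curved unfolding uniformly_curved_def by blast
  \<comment> \<open>\<open>mixing k\<close> is half of the walk on mean-zero functions, so 1/4 here
    means 1/2 there. \<open>k\<close> is chosen before the graph.\<close>
  obtain k where k: "\<Delta> (sqrt q ^ k / 2) < 1/4"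
  proof -
    have "(\<lambda>k. sqrt q ^ k / 2) \<longlonglongrightarrow> 0 / 2"
      using q by (intro tendsto_divide LIMSEQ_power_zero) auto
    then have "filterlim (\<lambda>k. sqrt q ^ k / 2) (at_right 0) sequentially"
      using q by (auto simp: filterlim_at)
    then have "(\<lambda>k. \<Delta> (sqrt q ^ k / 2)) \<longlonglongrightarrow> 0"
      using \<Delta> by (rule filterlim_compose[rotated])
    then have "eventually (\<lambda>k. \<Delta> (sqrt q ^ k / 2) < 1/4) sequentially"
      by (rule order_tendstoD) simp
    then show thesis
      using that eventually_happens[of _ sequentially] by auto
  qed
  show ?thesis
  \<comment> \<open>One factor 4 comes from absorbing half of \<open>S\<close>, the other from
    comparing pairs with the centred norm.\<close>
  proof (intro exI[of _ "16 * (real k * L)\<^sup>2"] allI impI)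
    fix V :: "real set" and E and F :: "real \<Rightarrow> 'e"
    assume V: "expander V E N c" and F: "\<forall>x\<in>V. \<forall>y\<in>V. E x y \<longrightarrow> dist (F x) (F y) \<le> L"
    interpret expander V E N c by fact
    have poincare2: "(\<Sum>x\<in>V. \<Sum>y\<in>V. (norm (f x - f y))\<^sup>2)
      \<le> C * real (card V) * edge_sum (\<lambda>x y. (norm (f x - f y))\<^sup>2)" for f :: "real \<Rightarrow> complex"
      using poincare[rule_format, OF V, of f] by simp
    have tensor: "tensor_id_bound TYPE('e) (count_space V) (mixing k) (\<Delta> (sqrt q ^ k / 2))"
      using q C by (intro bound mixing_L2_operator_bound[OF C poincare2] mixing_L1_contractive mixing_Linf_contractive) auto
    define G where "G x = F x - avg F" for x
    define S where "S = (\<Sum>x\<in>V. (norm (G x))\<^sup>2)"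
    have "avg G = 0" by (simp add: G_def[abs_def] avg_diff avg_const)
    have "S \<ge> 0" by (simp add: S_def sum_nonneg)
    have "sqrt (\<Sum>x\<in>V. (norm (mixing k G x))\<^sup>2) \<le> \<Delta> (sqrt q ^ k / 2) * sqrt S"
      unfolding S_def by (rule tensor_bound_mixing[OF tensor])
    also have "\<dots> \<le> 1/4 * sqrt S"
      using k \<open>0 \<le> S\<close> by (intro mult_right_mono) auto
    also have "\<dots> = sqrt (S / 16)"
      by (simp add: real_sqrt_divide)
    finally have "(\<Sum>x\<in>V. (norm (mixing k G x))\<^sup>2) \<le> S / 16"
      by simp
    moreover have "(\<Sum>x\<in>V. (norm (mixing k G x))\<^sup>2) = (\<Sum>x\<in>V. (norm ((walk ^^ k) G x))\<^sup>2) / 4"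
      using \<open>avg G = 0\<close> by (simp add: mixing_def power_divide sum_divide_distrib)
    ultimately have walk_small: "(\<Sum>x\<in>V. (norm ((walk ^^ k) G x))\<^sup>2) \<le> S / 4"
      by simp
    have square: "(norm (a + b))\<^sup>2 \<le> 2 * (norm a)\<^sup>2 + 2 * (norm b)\<^sup>2" for a b :: 'e
    proof -
      have "(norm (a + b))\<^sup>2 \<le> (norm a + norm b)\<^sup>2"
        by (intro power_mono norm_triangle_ineq) auto
      also have "\<dots> \<le> 2 * (norm a)\<^sup>2 + 2 * (norm b)\<^sup>2"
        using sum_squares_bound[of "norm a" "norm b"] by (simp add: power2_sum)
      finally show ?thesis .
    qed
    \<comment> \<open>\<open>G\<close> is split into its k-step walk, which contributes at most
      \<open>S / 2\<close>, and its displacement.\<close>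
    have "S \<le> (\<Sum>x\<in>V. 2 * (norm ((walk ^^ k) G x))\<^sup>2 + 2 * (real k * L)\<^sup>2)"
      unfolding S_def
    proof (rule sum_mono)
      fix x assume "x \<in> V"
      have "norm ((walk ^^ k) G x - G x) \<le> real k * L"
        using F assms(4) \<open>x \<in> V\<close> by (intro walk_iter_displacement) (auto simp: G_def dist_norm)
      then have "(norm (G x - (walk ^^ k) G x))\<^sup>2 \<le> (real k * L)\<^sup>2"
        by (intro power_mono) (simp_all add: norm_minus_commute)
      then show "(norm (G x))\<^sup>2 \<le> 2 * (norm ((walk ^^ k) G x))\<^sup>2 + 2 * (real k * L)\<^sup>2"
        using square[of "(walk ^^ k) G x" "G x - (walk ^^ k) G x"] by simp
    qed
    also have "\<dots> = 2 * (\<Sum>x\<in>V. (norm ((walk ^^ k) G x))\<^sup>2) + 2 * real (card V) * (real k * L)\<^sup>2"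
      by (simp add: sum.distrib flip: sum_distrib_left)
    also have "\<dots> \<le> S / 2 + 2 * real (card V) * (real k * L)\<^sup>2"
      using walk_small by simp
    finally have S: "S \<le> 4 * real (card V) * (real k * L)\<^sup>2"
      by simp
    have "(\<Sum>x\<in>V. \<Sum>y\<in>V. dist (F x) (F y) powr 2) \<le> (\<Sum>x\<in>V. \<Sum>y\<in>V. 2 * (norm (G x))\<^sup>2 + 2 * (norm (G y))\<^sup>2)"
    proof (intro sum_mono)
      fix x y
      have "dist (F x) (F y) = norm (G x + - G y)"
        by (simp add: G_def dist_norm)
      then show "dist (F x) (F y) powr 2 \<le> 2 * (norm (G x))\<^sup>2 + 2 * (norm (G y))\<^sup>2"
        using square[of "G x" "- G y"] by simp
    qed
    also have "\<dots> = 4 * real (card V) * S"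
      by (simp add: sum.distrib S_def flip: sum_distrib_left)
    also have "\<dots> \<le> 4 * real (card V) * (4 * real (card V) * (real k * L)\<^sup>2)"
      using S by (intro mult_left_mono) auto
    also have "\<dots> = 16 * (real k * L)\<^sup>2 * (real (card V))\<^sup>2"
      by (simp add: power2_eq_square)
    finally show "(\<Sum>x\<in>V. \<Sum>y\<in>V. dist (F x) (F y) powr 2) \<le> 16 * (real k * L)\<^sup>2 * (real (card V))\<^sup>2" .
  qed
qed

section \<open>Coarse embeddings\<close>

text \<open>Uniform curvature is tested on measures over the reals; this moves a vertex set of any
  type there.\<close>

lemma expander_image:
  assumes "expander V E N c" "inj_on g V"
  shows "expander (g ` V) (\<lambda>s t. E (inv_into V g s) (inv_into V g t)) N c"
proof -
  interpret expander V E N c by fact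
  let ?h = "inv_into V g"
  have h: "?h (g x) = x" if "x \<in> V" for x
    using that assms(2) by simp
  have card_img: "card (g ` A) = card A" if "A \<subseteq> V" for A
    using that assms(2) by (intro card_image) (auto intro: inj_on_subset)
  show ?thesis
  proof
    fix s assume "s \<in> g ` V"
    then obtain x where x: "x \<in> V" "s = g x" by auto
    have "{t \<in> g ` V. E (?h s) (?h t)} = g ` {y\<in>V. E x y}"
      using x h by auto
    then show "card {t \<in> g ` V. E (?h s) (?h t)} \<le> N"
      using degree[OF x(1)] card_img[of "{y\<in>V. E x y}"] by simp
  next
    fix A assume A: "A \<subseteq> g ` V" "A \<noteq> {}" "2 * card A \<le> card (g ` V)"
    then obtain B where B: "B \<subseteq> V" "A = g ` B"
      by (auto simp: subset_image_iff)
    have diff: "g ` V - g ` B = g ` (V - B)"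
      using inj_on_image_set_diff[OF assms(2), of V B] B(1) by auto
    have ex: "(\<exists>s\<in>g ` B. E (?h s) y) \<longleftrightarrow> (\<exists>x\<in>B. E x y)" for y
      using B(1) h by (auto simp: subset_iff)
    have "{t \<in> g ` V - A. \<exists>s\<in>A. E (?h s) (?h t)} = g ` {y \<in> V - B. \<exists>x\<in>B. E x y}"
      unfolding B(2) ex diff using h by (auto intro!: imageI)
    then show "c * real (card A) \<le> real (card {t \<in> g ` V - A. \<exists>s\<in>A. E (?h s) (?h t)})"
      using expansion[of B] A B card_img[of B] card_img[of V] card_img[of "{y \<in> V - B. \<exists>x\<in>B. E x y}"]
      by auto
  qed (use finite_V V_nonempty N_pos c_pos E_sym in auto)
qed

text \<open>By averaging, some row has mean at most \<open>K\<close>, and by Markov's inequality at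
  most half of its entries exceed \<open>2 * K\<close>.\<close>

lemma close_pairs:
  fixes h :: "'a \<Rightarrow> 'a \<Rightarrow> real"
  assumes "finite V" "V \<noteq> {}" "0 < K"
    and nonneg: "\<And>x y. x \<in> V \<Longrightarrow> y \<in> V \<Longrightarrow> 0 \<le> h x y"
    and sum: "(\<Sum>x\<in>V. \<Sum>y\<in>V. h x y) \<le> K * (real (card V))\<^sup>2"
  obtains x where "x \<in> V" "card V \<le> 2 * card {y\<in>V. h x y \<le> 2 * K}"
proof -
  obtain x where x: "x \<in> V" "(\<Sum>y\<in>V. h x y) \<le> K * real (card V)"
  proof -
    have "\<exists>x\<in>V. (\<Sum>y\<in>V. h x y) \<le> K * real (card V)"
    proof (rule ccontr)
      assume "\<not> ?thesis"
      then have "(\<Sum>x\<in>V. K * real (card V)) < (\<Sum>x\<in>V. \<Sum>y\<in>V. h x y)"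
        using assms by (intro sum_strict_mono) auto
      then show False using sum by (simp add: power2_eq_square algebra_simps)
    qed
    then show thesis using that by blast
  qed
  have "2 * K * real (card {y\<in>V. 2 * K < h x y}) = (\<Sum>y\<in>{y\<in>V. 2 * K < h x y}. 2 * K)"
    by simp
  also have "\<dots> \<le> (\<Sum>y\<in>{y\<in>V. 2 * K < h x y}. h x y)"
    by (intro sum_mono) auto
  also have "\<dots> \<le> (\<Sum>y\<in>V. h x y)"
    using assms x by (intro sum_mono2) auto
  also note x(2)
  finally have "2 * real (card {y\<in>V. 2 * K < h x y}) \<le> real (card V)"
    using assms(3) by simp
  moreover have "card V = card {y\<in>V. 2 * K < h x y} + card {y\<in>V. h x y \<le> 2 * K}"
    using assms by (subst card_Un_disjoint[symmetric]) (auto intro!: arg_cong[of _ _ card])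
  ultimately show ?thesis using that x by simp
qed

text \<open>The Poincare inequality is a hypothesis so that all targets share the argument.
  \<open>dZ\<close> is an arbitrary function because \<open>Lp_dist\<close> is only a pseudometric;
  it is nonnegative on the image by the lower control function.\<close>

lemma not_coarsely_embeddable:
  fixes X :: "nat \<Rightarrow> 'a set" and dZ :: "'b \<Rightarrow> 'b \<Rightarrow> real"
  assumes exp: "asymptotic_expanders X d" and geo: "uniformly_bounded_geometry X d"
    and union: "is_coarse_disjoint_union X d D" and p: "0 < p"
    and poincare: "\<And>N c L. 0 < N \<Longrightarrow> 0 < c \<Longrightarrow> 0 \<le> L \<Longrightarrow>
      \<exists>K. \<forall>V E (F :: 'a \<Rightarrow> 'b). expander V E N c \<longrightarrow> F \<in> V \<rightarrow> Z \<longrightarrow>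
        (\<forall>x\<in>V. \<forall>y\<in>V. E x y \<longrightarrow> dZ (F x) (F y) \<le> L) \<longrightarrow>
        (\<Sum>x\<in>V. \<Sum>y\<in>V. dZ (F x) (F y) powr p) \<le> K * (real (card V))\<^sup>2"
  shows "\<not> coarsely_embeddable (Sigma UNIV X) D Z dZ"
proof
  assume "coarsely_embeddable (Sigma UNIV X) D Z dZ"
  then obtain f \<rho>1 \<rho>2 where f: "f \<in> Sigma UNIV X \<rightarrow> Z"
    and ctrl: "control_function \<rho>1" "control_function \<rho>2"
    and \<rho>: "\<And>u v. u \<in> Sigma UNIV X \<Longrightarrow> v \<in> Sigma UNIV X \<Longrightarrow>
      \<rho>1 (D u v) \<le> dZ (f u) (f v) \<and> dZ (f u) (f v) \<le> \<rho>2 (D u v)"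
    unfolding coarsely_embeddable_def coarse_embedding_def by blast
  have DX: "D (n, x) (n, y) = d n x y" if "x \<in> X n" "y \<in> X n" for n x y
    using union that by (simp add: is_coarse_disjoint_union_def)
  have ms: "Metric_space (X n) (d n)" and finX: "finite (X n)" for n
    using exp by (auto simp: asymptotic_expanders_def)
  have d0: "0 \<le> d n x y" for n x y
    using ms Metric_space.nonneg by fast
  have \<rho>1: "0 \<le> \<rho>1 t" if "0 \<le> t" for t
    using ctrl that by (auto simp: control_function_def)
  have bounds: "\<rho>1 (d n x y) \<le> dZ (f (n, x)) (f (n, y))" "dZ (f (n, x)) (f (n, y)) \<le> \<rho>2 (d n x y)"
    "0 \<le> dZ (f (n, x)) (f (n, y))"
    if "x \<in> X n" "y \<in> X n" for n x y
    using \<rho>[of "(n, x)" "(n, y)"] DX[OF that] \<rho>1[OF d0, of n x y] that by auto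
  obtain c R where c: "0 < c" and R: "0 < R" and
    c_exp: "\<And>n A. A \<subseteq> X n \<Longrightarrow> 1/4 * real (card (X n)) \<le> real (card A) \<Longrightarrow>
       real (card A) \<le> 1/2 * real (card (X n)) \<Longrightarrow>
       c * real (card A) < real (card (outer_boundary (X n) (d n) R A))"
  proof -
    have "0 < (1/4::real) \<and> (1/4::real) \<le> 1/2 \<longrightarrow> (\<exists>c R. 0 < c \<and> c < 1 \<and> 0 < R \<and>
        (\<forall>n A. A \<subseteq> X n \<and> 1/4 * real (card (X n)) \<le> real (card A) \<and>
          real (card A) \<le> 1/2 * real (card (X n)) \<longrightarrow>
          c * real (card A) < real (card (outer_boundary (X n) (d n) R A))))"
      using exp unfolding asymptotic_expanders_def by (elim conjE) (erule spec)
    then show thesis using that by auto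
  qed
  obtain N where N: "0 < N" "\<And>n x. x \<in> X n \<Longrightarrow> card (Metric_space.mcball (X n) (d n) x R) \<le> N"
  proof -
    obtain N where "\<And>n x. x \<in> X n \<Longrightarrow> card (Metric_space.mcball (X n) (d n) x R) \<le> N"
      using geo R unfolding uniformly_bounded_geometry_def by blast
    then show thesis by (intro that[of "Suc N"]) (auto intro: le_SucI)
  qed
  define c' where "c' = c / (2 * real N)"
  have c': "0 < c'" using c N by (simp add: c'_def)
  have "0 \<le> \<rho>2 R" using ctrl R by (auto simp: control_function_def)
  then obtain K where K: "\<forall>V E (F :: 'a \<Rightarrow> 'b). expander V E N c' \<longrightarrow> F \<in> V \<rightarrow> Z \<longrightarrow>
        (\<forall>x\<in>V. \<forall>y\<in>V. E x y \<longrightarrow> dZ (F x) (F y) \<le> \<rho>2 R) \<longrightarrow>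
        (\<Sum>x\<in>V. \<Sum>y\<in>V. dZ (F x) (F y) powr p) \<le> K * (real (card V))\<^sup>2"
    using poincare[OF N(1) c'] by blast
  \<comment> \<open>\<open>close_pairs\<close> asks for a positive bound; \<open>r\<close> undoes
    the p-th power in its conclusion.\<close>
  define K' where "K' = max K 1"
  define r where "r = (2 * K') powr (1 / p)"
  \<comment> \<open>Points further apart than \<open>R'\<close> have images further apart than
    \<open>r\<close>. Adding 1 makes the radius positive, as bounded geometry asks.\<close>
  obtain R' where R': "0 < R'" "r < \<rho>1 R'"
  proof -
    have "\<not> bdd_above (\<rho>1 ` {0..})" "mono_on {0..} \<rho>1"
      using ctrl by (auto simp: control_function_def)
    then obtain t where t: "0 \<le> t" "r < \<rho>1 t"
      by (force simp: bdd_above_def not_le)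
    then have "\<rho>1 t \<le> \<rho>1 (t + 1)"
      using \<open>mono_on {0..} \<rho>1\<close> by (auto simp: mono_on_def)
    then show thesis using t by (intro that[of "t + 1"]) auto
  qed
  obtain N' where N': "\<And>n x. x \<in> X n \<Longrightarrow> card (Metric_space.mcball (X n) (d n) x R') \<le> N'"
    using geo R' unfolding uniformly_bounded_geometry_def by blast
  \<comment> \<open>The expander will keep at least 3N' + 3 points, while half of them will lie in a
    ball of at most N' points.\<close>
  have "eventually (\<lambda>n. 4 * N' + 4 \<le> card (X n)) sequentially"
    using exp by (auto simp: asymptotic_expanders_def filterlim_at_top)
  then obtain n where n: "4 * N' + 4 \<le> card (X n)"
    by (metis eventually_sequentially order_refl)
  interpret Metric_space "X n" "d n" by (rule ms)
  obtain Y where Y: "Y \<subseteq> X n" "3/4 * real (card (X n)) \<le> real (card Y)"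
    and Y_exp: "\<forall>A\<subseteq>Y. A \<noteq> {} \<longrightarrow> 2 * card A \<le> card Y \<longrightarrow>
       c' * real (card A) \<le> real (card {y \<in> Y - A. \<exists>x\<in>A. d n x y \<le> R})"
    using expander_subset[OF ms finX c N c_exp] unfolding c'_def by blast
  have finY: "finite Y" using Y finX finite_subset by blast
  have Y_ne: "Y \<noteq> {}" using Y n by auto
  have "expander Y (\<lambda>x y. d n x y \<le> R) N c'"
  proof
    fix x assume "x \<in> Y"
    then have "card {y \<in> Y. d n x y \<le> R} \<le> card (mcball x R)"
      using Y finX by (intro card_mono) (auto intro: finite_subset[OF _ finX])
    also have "\<dots> \<le> N" using N Y \<open>x \<in> Y\<close> by auto
    finally show "card {y \<in> Y. d n x y \<le> R} \<le> N" .
  qed (use finY Y_ne N c' Y_exp commute in auto)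
  moreover have "dZ (f (n, x)) (f (n, y)) \<le> \<rho>2 R" if "x \<in> Y" "y \<in> Y" "d n x y \<le> R" for x y
  proof -
    have "\<rho>2 (d n x y) \<le> \<rho>2 R"
      using ctrl that d0 R by (auto simp: control_function_def mono_on_def)
    then show ?thesis using bounds(2)[of x n y] that Y by force
  qed
  ultimately have "(\<Sum>x\<in>Y. \<Sum>y\<in>Y. dZ (f (n, x)) (f (n, y)) powr p) \<le> K * (real (card Y))\<^sup>2"
    using Y f 
    by (intro K[rule_format, of Y "\<lambda>x y. d n x y \<le> R" "\<lambda>x. f (n, x)"]) auto
  also have "\<dots> \<le> K' * (real (card Y))\<^sup>2"
    by (intro mult_right_mono) (auto simp: K'_def)
  finally have S: "(\<Sum>x\<in>Y. \<Sum>y\<in>Y. dZ (f (n, x)) (f (n, y)) powr p) \<le> K' * (real (card Y))\<^sup>2" .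
  have K'_pos: "0 < K'" by (simp add: K'_def)
  obtain x where x: "x \<in> Y"
      "card Y \<le> 2 * card {y \<in> Y. dZ (f (n, x)) (f (n, y)) powr p \<le> 2 * K'}"
    by (rule close_pairs[OF finY Y_ne K'_pos _ S]) auto
  have "{y \<in> Y. dZ (f (n, x)) (f (n, y)) powr p \<le> 2 * K'} \<subseteq> mcball x R'"
  proof
    fix y assume y: "y \<in> {y \<in> Y. dZ (f (n, x)) (f (n, y)) powr p \<le> 2 * K'}"
    then have xy: "x \<in> X n" "y \<in> X n" using Y x by auto
    have "dZ (f (n, x)) (f (n, y)) = (dZ (f (n, x)) (f (n, y)) powr p) powr (1 / p)"
      using bounds(3)[OF xy] p by (simp add: powr_powr)
    also have "\<dots> \<le> r"
      unfolding r_def using y p by (intro powr_mono2) auto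
    finally have "\<rho>1 (d n x y) < \<rho>1 R'"
      using bounds(1)[OF xy] R' by linarith
    then have "d n x y \<le> R'"
      using ctrl R' d0[of n x y] by (force simp: control_function_def mono_on_def not_le[symmetric])
    then show "y \<in> mcball x R'" using xy by simp
  qed
  then have "card {y \<in> Y. dZ (f (n, x)) (f (n, y)) powr p \<le> 2 * K'} \<le> card (mcball x R')"
    using finX by (intro card_mono) (auto intro: finite_subset[OF _ finX])
  also have "\<dots> \<le> N'" using N' x Y by auto
  finally show False
    using x(2) Y(2) n by linarith
qed

theorem theoremB:
  fixes X :: "nat \<Rightarrow> 'a set"
    and d :: "nat \<Rightarrow> 'a \<Rightarrow> 'a \<Rightarrow> real"
    and D :: "nat \<times> 'a \<Rightarrow> nat \<times> 'a \<Rightarrow> real"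
  assumes "asymptotic_expanders X d"
    and "uniformly_bounded_geometry X d"
    and "is_coarse_disjoint_union X d D"
  shows "(\<forall>(M :: 'w measure) p. 1 \<le> p \<longrightarrow>
            \<not> coarsely_embeddable (Sigma UNIV X) D (Lp_fun M p :: ('w \<Rightarrow> real) set) (Lp_dist M p) \<and>
            \<not> coarsely_embeddable (Sigma UNIV X) D (Lp_fun M p :: ('w \<Rightarrow> complex) set) (Lp_dist M p)) \<and>
         (uniformly_curved TYPE('e::complex_banach) \<longrightarrow>
            \<not> coarsely_embeddable (Sigma UNIV X) D (UNIV :: 'e set) dist)"
proof (intro conjI allI impI)
  fix M :: "'w measure" and p :: real
  assume "1 \<le> p"
  then have p: "0 < p" by simp
  show "\<not> coarsely_embeddable (Sigma UNIV X) D (Lp_fun M p :: ('w \<Rightarrow> real) set) (Lp_dist M p)"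
  proof (rule not_coarsely_embeddable[OF assms p])
    fix N :: nat and c L :: real
    assume "0 < N" "0 < c"
    then obtain C where C: "0 < C" and poincare: "\<forall>V E (f :: 'a \<Rightarrow> real). expander V E N c \<longrightarrow>
       (\<Sum>x\<in>V. \<Sum>y\<in>V. \<bar>f x - f y\<bar> powr p)
         \<le> C * real (card V) * expander.edge_sum V E (\<lambda>x y. \<bar>f x - f y\<bar> powr p)"
      using real_poincare[OF _ _ p, where ?'a = 'a] by blast
    show "\<exists>K. \<forall>V E (F :: 'a \<Rightarrow> 'w \<Rightarrow> real). expander V E N c \<longrightarrow> F \<in> V \<rightarrow> Lp_fun M p \<longrightarrow>
        (\<forall>x\<in>V. \<forall>y\<in>V. E x y \<longrightarrow> Lp_dist M p (F x) (F y) \<le> L) \<longrightarrow>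
        (\<Sum>x\<in>V. \<Sum>y\<in>V. Lp_dist M p (F x) (F y) powr p) \<le> K * (real (card V))\<^sup>2"
    proof (intro exI[of _ "C * real N * L powr p"] allI impI)
      fix V :: "'a set" and E and F :: "'a \<Rightarrow> 'w \<Rightarrow> real"
      assume V: "expander V E N c" and "F \<in> V \<rightarrow> Lp_fun M p"
        and "\<forall>x\<in>V. \<forall>y\<in>V. E x y \<longrightarrow> Lp_dist M p (F x) (F y) \<le> L"
      then show "(\<Sum>x\<in>V. \<Sum>y\<in>V. Lp_dist M p (F x) (F y) powr p) \<le> C * real N * L powr p * (real (card V))\<^sup>2"
        using poincare by (intro expander.Lp_poincare[OF V p C]) auto
    qed
  qed
  show "\<not> coarsely_embeddable (Sigma UNIV X) D (Lp_fun M p :: ('w \<Rightarrow> complex) set) (Lp_dist M p)"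
  proof (rule not_coarsely_embeddable[OF assms p])
    fix N :: nat and c L :: real
    assume "0 < N" "0 < c"
    then obtain C where C: "0 < C" and poincare: "\<forall>V E (f :: 'a \<Rightarrow> complex). expander V E N c \<longrightarrow>
       (\<Sum>x\<in>V. \<Sum>y\<in>V. norm (f x - f y) powr p)
         \<le> C * real (card V) * expander.edge_sum V E (\<lambda>x y. norm (f x - f y) powr p)"
      using complex_poincare[OF _ _ p, where ?'a = 'a] by blast
    show "\<exists>K. \<forall>V E (F :: 'a \<Rightarrow> 'w \<Rightarrow> complex). expander V E N c \<longrightarrow> F \<in> V \<rightarrow> Lp_fun M p \<longrightarrow>
        (\<forall>x\<in>V. \<forall>y\<in>V. E x y \<longrightarrow> Lp_dist M p (F x) (F y) \<le> L) \<longrightarrow>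
        (\<Sum>x\<in>V. \<Sum>y\<in>V. Lp_dist M p (F x) (F y) powr p) \<le> K * (real (card V))\<^sup>2"
    proof (intro exI[of _ "C * real N * L powr p"] allI impI)
      fix V :: "'a set" and E and F :: "'a \<Rightarrow> 'w \<Rightarrow> complex"
      assume V: "expander V E N c" and "F \<in> V \<rightarrow> Lp_fun M p"
        and "\<forall>x\<in>V. \<forall>y\<in>V. E x y \<longrightarrow> Lp_dist M p (F x) (F y) \<le> L"
      then show "(\<Sum>x\<in>V. \<Sum>y\<in>V. Lp_dist M p (F x) (F y) powr p) \<le> C * real N * L powr p * (real (card V))\<^sup>2"
        using poincare by (intro expander.Lp_poincare[OF V p C]) auto
    qed
  qed
next
  assume curved: "uniformly_curved TYPE('e)"
  show "\<not> coarsely_embeddable (Sigma UNIV X) D (UNIV :: 'e set) dist"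
  proof (rule not_coarsely_embeddable[OF assms, of 2])
    fix N :: nat and c L :: real
    assume "0 < N" "0 < c" "0 \<le> L"
    then obtain K where K: "\<forall>(V :: real set) E (F :: real \<Rightarrow> 'e). expander V E N c \<longrightarrow>
        (\<forall>x\<in>V. \<forall>y\<in>V. E x y \<longrightarrow> dist (F x) (F y) \<le> L) \<longrightarrow>
        (\<Sum>x\<in>V. \<Sum>y\<in>V. dist (F x) (F y) powr 2) \<le> K * (real (card V))\<^sup>2"
      using uniformly_curved_poincare[OF curved] by blast
    show "\<exists>K. \<forall>V E (F :: 'a \<Rightarrow> 'e). expander V E N c \<longrightarrow> F \<in> V \<rightarrow> UNIV \<longrightarrow>
        (\<forall>x\<in>V. \<forall>y\<in>V. E x y \<longrightarrow> dist (F x) (F y) \<le> L) \<longrightarrow>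
        (\<Sum>x\<in>V. \<Sum>y\<in>V. dist (F x) (F y) powr 2) \<le> K * (real (card V))\<^sup>2"
    proof (intro exI[of _ K] allI impI)
      fix V :: "'a set" and E and F :: "'a \<Rightarrow> 'e"
      assume V: "expander V E N c" and F: "\<forall>x\<in>V. \<forall>y\<in>V. E x y \<longrightarrow> dist (F x) (F y) \<le> L"
      have "finite V" using V by (rule expander.finite_V)
      \<comment> \<open>Any injection of the finite vertex set into the reals would do;
        \<open>F\<close> is transported along its inverse.\<close>
      define g where "g = real \<circ> to_nat_on V"
      have g: "inj_on g V"
        using \<open>finite V\<close> unfolding g_def
        by (intro comp_inj_on inj_on_to_nat_on countable_finite) (auto simp: inj_on_def)
      have "(\<Sum>x\<in>g ` V. \<Sum>y\<in>g ` V. dist (F (inv_into V g x)) (F (inv_into V g y)) powr 2)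
          \<le> K * (real (card (g ` V)))\<^sup>2"
        using F g by (intro K[rule_format, OF expander_image[OF V g]]) auto
      then show "(\<Sum>x\<in>V. \<Sum>y\<in>V. dist (F x) (F y) powr 2) \<le> K * (real (card V))\<^sup>2"
        using g by (simp add: sum.reindex card_image)
    qed
  qed simp
qed

end
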